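(* The block diagonal operators $\mathcal P_h^c$ and $\mathcal P_h^d$ are uniform preconditioners for $\mathcal L_h^c$ and $\mathcal L_h^d$ respectively; i.e. the operator norms $$\|\mathcal P_h^c\mathcal L_h^c\|,\quad\|(\mathcal P_h^c\mathcal L_h^c)^{-1}\|\quad\text{on } S_h\times\boldsymbol U_h,\qquad\|\mathcal P_h^d\mathcal L_h^d\|,\quad\|(\mathcal P_h^d\mathcal L_h^d)^{-1}\|\quad\text{on }\boldsymbol U_h\times\boldsymbol V_h$$ (with respect to the product norm $(\|\cdot\|_M,\|\cdot\|_A)$) are bounded by constants independent of $h$.
   Context: Setting. $\Omega\subset\mathbb R^3$ is a bounded convex polyhedron homeomorphic to a ball, $(\cdot,\cdot)$ is the $L^2(\Omega)$ inner product, and $\mathcal T_h$ is a mesh of size $h$ from a shape-regular quasi-uniform family. $S_h\subset H^1_0$ (Lagrange elements), $\boldsymbol U_h\subset\boldsymbol H_0(\mathrm{curl})$ (edge elements), $\boldsymbol V_h\subset\boldsymbol H_0(\mathrm{div})$ (face elements), $W_h\subset L_0^2$ (discontinuous piecewise polynomials) are finite element spaces on $\mathcal T_h$ such that $0\to S_h\xrightarrow{\mathrm{grad}}\boldsymbol U_h\xrightarrow{\mathrm{curl}}\boldsymbol V_h\xrightarrow{\mathrm{div}}W_h\to0$ is exact. Primes denote dual spaces and $\langle\cdot,\cdot\rangle$ the duality pairing. Curl case: $\langle M_v\sigma,\tau\rangle=(\sigma,\tau)$ for $\sigma,\tau\in S_h$; $B:\boldsymbol U_h\to S_h'$, $\langle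 B\boldsymbol u,\tau\rangle=(\boldsymbol u,\mathrm{grad}\,\tau)$; $C^TM_fC:\boldsymbol U_h\to\boldsymbol U_h'$, $\langle C^TM_fC\boldsymbol u,\boldsymbol v\rangle=(\mathrm{curl}\,\boldsymbol u,\mathrm{curl}\,\boldsymbol v)$. Then $$\mathcal L_h^c=\begin{pmatrix} -M_v & B \\ B^T & C^TM_fC \end{pmatrix},\quad A_h^c=B^TM_v^{-1}B+C^TM_fC,\quad\mathcal P_h^c=\begin{pmatrix} M_v^{-1} & 0 \\ 0 & (A_h^c)^{-1} \end{pmatrix}.$$ Div case: $\langle M_e\boldsymbol\sigma,\boldsymbol\tau\rangle=(\boldsymbol\sigma,\boldsymbol\tau)$ for $\boldsymbol\sigma,\boldsymbol\tau\in\boldsymbol U_h$; here $C:\boldsymbol U_h\to\boldsymbol V_h'$, $\langle C\boldsymbol\sigma,\boldsymbol v\rangle=(\mathrm{curl}\,\boldsymbol\sigma,\boldsymbol v)$; and $B^TM_tB:\boldsymbol V_h\to\boldsymbol V_h'$, $\langle B^TM_tB\boldsymbol u,\boldsymbol v\rangle=(\mathrm{div}\,\boldsymbol u,\mathrm{div}\,\boldsymbol v)$. Then $$\mathcal L_h^d=\begin{pmatrix} -M_e & C^T \\ C & B^TM_tB \end{pmatrix},\quad A_h^d=CM_e^{-1}C^T+B^TM_tB,\quad\mathcal P_h^d=\begin{pmatrix} M_e^{-1} & 0 \\ 0 & (A_h^d)^{-1} \end{pmatrix}.$$ With $M=M_v$, $A=A_h^c$ in the curl case and $M=M_e$, $A=A_h^d$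 in the div case, $\|\sigma\|_M^2=\langle M\sigma,\sigma\rangle$ and $\|u\|_A^2=\langle Au,u\rangle$; the product space carries the product norm, e.g. $\|\sigma\|_M+\|u\|_A$. The matrices $M_v,M_e,A_h^c,A_h^d$ are symmetric positive definite. *)

theory Defs
  imports "HOL-Analysis.Analysis"
begin

unbundle no cross3_syntax

section \<open>Square integrable fields on \<open>\<real>\<^sup>3\<close>\<close>

text \<open>
  Elements of \<open>'b l2\<close> are classes of square integrable functions modulo equality almost everywhere,
  so that \<open>L\<^sup>2(\<Omega>)\<close> is the subspace of the classes vanishing a.e. outside \<open>\<Omega>\<close>, and finite element
  functions are determined by their values on the open cells.
\<close>

type_synonym space = "real^3"

definition square_integrable :: "(space \<Rightarrow> 'b::euclidean_space) \<Rightarrow> bool" where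
  "square_integrable f \<longleftrightarrow> f \<in> borel_measurable lborel \<and> integrable lborel (\<lambda>x. (norm (f x))\<^sup>2)"

lemma square_integrable_inner:
  assumes "square_integrable f" "square_integrable g"
  shows "integrable lborel (\<lambda>x. f x \<bullet> g x)"
proof (rule Bochner_Integration.integrable_bound)
  show "integrable lborel (\<lambda>x. (norm (f x))\<^sup>2 + (norm (g x))\<^sup>2)"
    using assms by (simp add: square_integrable_def)
  show "(\<lambda>x. f x \<bullet> g x) \<in> borel_measurable lborel"
    using assms by (auto simp: square_integrable_def intro!: borel_measurable_inner)
  have "norm (f x \<bullet> g x) \<le> norm ((norm (f x))\<^sup>2 + (norm (g x))\<^sup>2)" for x
  proof -
    have "\<bar>f x \<bullet> g x\<bar> \<le> norm (f x) * norm (g x)" by (rule Cauchy_Schwarz_ineq2)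
    also have "\<dots> \<le> (norm (f x))\<^sup>2 + (norm (g x))\<^sup>2"
      using sum_squares_bound[of "norm (f x)" "norm (g x)"]
        mult_nonneg_nonneg[OF norm_ge_zero[of "f x"] norm_ge_zero[of "g x"]] by linarith
    finally show ?thesis by simp
  qed
  then show "AE x in lborel. norm (f x \<bullet> g x) \<le> norm ((norm (f x))\<^sup>2 + (norm (g x))\<^sup>2)" by simp
qed

lemma square_integrable_zero: "square_integrable (\<lambda>x. 0)"
  by (simp add: square_integrable_def)

lemma square_integrable_add:
  assumes "square_integrable f" "square_integrable g"
  shows "square_integrable (\<lambda>x. f x + g x)"
proof -
  have "integrable lborel (\<lambda>x. (norm (f x))\<^sup>2 + (norm (g x))\<^sup>2 + 2 * (f x \<bullet> g x))"
    using assms square_integrable_inner[OF assms] by (simp add: square_integrable_def)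
  moreover have "(\<lambda>x. (norm (f x))\<^sup>2 + (norm (g x))\<^sup>2 + 2 * (f x \<bullet> g x)) = (\<lambda>x. (norm (f x + g x))\<^sup>2)"
    by (simp add: power2_norm_eq_inner inner_add_left inner_add_right inner_commute fun_eq_iff)
  ultimately show ?thesis
    using assms by (auto simp: square_integrable_def intro!: borel_measurable_add)
qed

lemma square_integrable_scaleR:
  assumes "square_integrable f" shows "square_integrable (\<lambda>x. c *\<^sub>R f x)"
  using assms by (auto simp: square_integrable_def power_mult_distrib intro!: borel_measurable_scaleR)

lemma square_integrable_uminus:
  assumes "square_integrable f" shows "square_integrable (\<lambda>x. - f x)"
  using square_integrable_scaleR[OF assms, of "-1"] by simp

lemma square_integrable_diff:
  assumes "square_integrable f" "square_integrable g"
  shows "square_integrable (\<lambda>x. f x - g x)"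
  using square_integrable_add[OF assms(1) square_integrable_uminus[OF assms(2)]] by simp

definition l2_rel :: "(space \<Rightarrow> 'b::euclidean_space) \<Rightarrow> (space \<Rightarrow> 'b) \<Rightarrow> bool" where
  "l2_rel f g \<longleftrightarrow> square_integrable f \<and> square_integrable g \<and> (AE x in lborel. f x = g x)"

quotient_type (overloaded) 'b l2 = "space \<Rightarrow> 'b::euclidean_space" / partial: l2_rel
proof (rule part_equivpI)
  show "\<exists>f. l2_rel f f" by (rule exI[of _ "\<lambda>x. 0"]) (simp add: l2_rel_def square_integrable_zero)
  show "symp l2_rel" by (auto simp: symp_def l2_rel_def elim: eventually_mono)
  show "transp l2_rel" unfolding transp_def l2_rel_def
    by (auto elim: eventually_elim2)
qed

instantiation l2 :: (euclidean_space) real_vector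
begin

lift_definition zero_l2 :: "'a l2" is "\<lambda>x. 0"
  by (simp add: l2_rel_def square_integrable_zero)

lift_definition plus_l2 :: "'a l2 \<Rightarrow> 'a l2 \<Rightarrow> 'a l2" is "\<lambda>f g x. f x + g x"
  by (auto simp: l2_rel_def square_integrable_add elim: eventually_elim2)

lift_definition uminus_l2 :: "'a l2 \<Rightarrow> 'a l2" is "\<lambda>f x. - f x"
  by (auto simp: l2_rel_def square_integrable_uminus)

lift_definition minus_l2 :: "'a l2 \<Rightarrow> 'a l2 \<Rightarrow> 'a l2" is "\<lambda>f g x. f x - g x"
  by (auto simp: l2_rel_def square_integrable_diff elim: eventually_elim2)

lift_definition scaleR_l2 :: "real \<Rightarrow> 'a l2 \<Rightarrow> 'a l2" is "\<lambda>c f x. c *\<^sub>R f x"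
  by (auto simp: l2_rel_def square_integrable_scaleR elim: eventually_mono)

instance
proof
  fix u v w :: "'a l2" and a b :: real
  show "u + v + w = u + (v + w)"
    by transfer (auto simp: l2_rel_def square_integrable_add add.assoc)
  show "u + v = v + u"
    by transfer (auto simp: l2_rel_def square_integrable_add add.commute)
  show "0 + u = u" by transfer (auto simp: l2_rel_def)
  show "- u + u = 0" by transfer (auto simp: l2_rel_def square_integrable_zero)
  show "u - v = u + - v"
    by transfer (auto simp: l2_rel_def square_integrable_diff square_integrable_add square_integrable_uminus)
  show "a *\<^sub>R (u + v) = a *\<^sub>R u + a *\<^sub>R v"
    by transfer (auto simp: l2_rel_def square_integrable_add square_integrable_scaleR scaleR_add_right)
  show "(a + b) *\<^sub>R u = a *\<^sub>R u + b *\<^sub>R u"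
    by transfer (auto simp: l2_rel_def square_integrable_add square_integrable_scaleR scaleR_add_left)
  show "a *\<^sub>R b *\<^sub>R u = (a * b) *\<^sub>R u"
    by transfer (auto simp: l2_rel_def square_integrable_scaleR)
  show "1 *\<^sub>R u = u" by transfer (auto simp: l2_rel_def)
qed

end

instantiation l2 :: (euclidean_space) real_inner
begin

lift_definition inner_l2 :: "'a l2 \<Rightarrow> 'a l2 \<Rightarrow> real" is "\<lambda>f g. LINT x|lborel. f x \<bullet> g x"
  by (rule integral_cong_AE)
     (auto simp: l2_rel_def square_integrable_def elim: eventually_elim2)

definition norm_l2 :: "'a l2 \<Rightarrow> real" where "norm_l2 u = sqrt (u \<bullet> u)"
definition sgn_l2 :: "'a l2 \<Rightarrow> 'a l2" where "sgn_l2 u = u /\<^sub>R norm u"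
definition dist_l2 :: "'a l2 \<Rightarrow> 'a l2 \<Rightarrow> real" where "dist_l2 u v = norm (u - v)"
definition uniformity_l2 :: "('a l2 \<times> 'a l2) filter" where
  "uniformity_l2 = (INF e\<in>{0<..}. principal {(u, v). dist u v < e})"
definition open_l2 :: "'a l2 set \<Rightarrow> bool" where
  "open_l2 U \<longleftrightarrow> (\<forall>u\<in>U. eventually (\<lambda>(u', v). u' = u \<longrightarrow> v \<in> U) uniformity)"

instance
proof
  fix u v w :: "'a l2" and a :: real
  show "sgn u = u /\<^sub>R norm u" by (rule sgn_l2_def)
  show "dist u v = norm (u - v)" by (rule dist_l2_def)
  show "norm u = sqrt (u \<bullet> u)" by (rule norm_l2_def)
  show "uniformity = (INF e\<in>{0<..}. principal {(u::'a l2, v). dist u v < e})"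
    by (rule uniformity_l2_def)
  show "u \<bullet> v = v \<bullet> u" by transfer (simp add: inner_commute)
  show "(u + v) \<bullet> w = u \<bullet> w + v \<bullet> w"
    by transfer (simp add: l2_rel_def inner_add_left square_integrable_inner)
  show "(a *\<^sub>R u) \<bullet> v = a * (u \<bullet> v)"
    by transfer simp
  show "0 \<le> u \<bullet> u" by transfer (auto intro: Bochner_Integration.integral_nonneg)
  show "u \<bullet> u = 0 \<longleftrightarrow> u = 0"
  proof transfer
    fix f :: "space \<Rightarrow> 'a" assume f: "l2_rel f f"
    then have "(LINT x|lborel. f x \<bullet> f x) = 0 \<longleftrightarrow> (AE x in lborel. f x \<bullet> f x = 0)"
      by (intro integral_nonneg_eq_0_iff_AE square_integrable_inner) (auto simp: l2_rel_def)
    then show "((LINT x|lborel. f x \<bullet> f x) = 0) = l2_rel f (\<lambda>x. 0)"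
      using f by (simp add: l2_rel_def square_integrable_zero)
  qed
next
  fix U :: "'a l2 set"
  show "open U \<longleftrightarrow> (\<forall>u\<in>U. eventually (\<lambda>(u', v). u' = u \<longrightarrow> v \<in> U) uniformity)"
    by (rule open_l2_def)
qed

end

definition L2 :: "space set \<Rightarrow> 'b::euclidean_space l2 set" where
  "L2 \<Omega> = {u. AE x in lborel. x \<notin> \<Omega> \<longrightarrow> rep_l2 u x = 0}"

definition L2_mean_zero :: "space set \<Rightarrow> real l2 set" where
  "L2_mean_zero \<Omega> = {w \<in> L2 \<Omega>. (LINT x:\<Omega>|lborel. rep_l2 w x) = 0}"


section \<open>Test functions, weak derivatives and Sobolev spaces\<close>

text \<open>Read coinductively: all iterated directional derivatives exist and are differentiable.\<close>

coinductive smooth :: "('a::euclidean_space \<Rightarrow> 'b::euclidean_space) \<Rightarrow> bool" where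
  "\<lbrakk>\<forall>x. f differentiable (at x); \<forall>v. smooth (\<lambda>x. frechet_derivative f (at x) v)\<rbrakk> \<Longrightarrow> smooth f"

definition test_functions :: "space set \<Rightarrow> (space \<Rightarrow> 'b::euclidean_space) set" where
  "test_functions \<Omega> = {\<phi>. smooth \<phi> \<and> compact (closure {x. \<phi> x \<noteq> 0}) \<and> closure {x. \<phi> x \<noteq> 0} \<subseteq> \<Omega>}"

definition partial_deriv :: "3 \<Rightarrow> (space \<Rightarrow> 'b::euclidean_space) \<Rightarrow> space \<Rightarrow> 'b" where
  "partial_deriv i \<phi> x = frechet_derivative \<phi> (at x) (axis i 1)"

definition grad :: "(space \<Rightarrow> real) \<Rightarrow> space \<Rightarrow> real^3" where
  "grad \<phi> x = (\<chi> i. partial_deriv i \<phi> x)"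

definition curl :: "(space \<Rightarrow> real^3) \<Rightarrow> space \<Rightarrow> real^3" where
  "curl \<phi> x = vector
     [partial_deriv 2 \<phi> x $ 3 - partial_deriv 3 \<phi> x $ 2,
      partial_deriv 3 \<phi> x $ 1 - partial_deriv 1 \<phi> x $ 3,
      partial_deriv 1 \<phi> x $ 2 - partial_deriv 2 \<phi> x $ 1]"

definition divergence :: "(space \<Rightarrow> real^3) \<Rightarrow> space \<Rightarrow> real" where
  "divergence \<phi> x = (\<Sum>i\<in>UNIV. partial_deriv i \<phi> x $ i)"

definition is_weak_grad :: "space set \<Rightarrow> real l2 \<Rightarrow> (real^3) l2 \<Rightarrow> bool" where
  "is_weak_grad \<Omega> u g \<longleftrightarrow> g \<in> L2 \<Omega> \<and>
     (\<forall>\<phi>\<in>test_functions \<Omega>. u \<bullet> abs_l2 (divergence \<phi>) = - (g \<bullet> abs_l2 \<phi>))"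

definition is_weak_curl :: "space set \<Rightarrow> (real^3) l2 \<Rightarrow> (real^3) l2 \<Rightarrow> bool" where
  "is_weak_curl \<Omega> u g \<longleftrightarrow> g \<in> L2 \<Omega> \<and>
     (\<forall>\<phi>\<in>test_functions \<Omega>. u \<bullet> abs_l2 (curl \<phi>) = g \<bullet> abs_l2 \<phi>)"

definition is_weak_div :: "space set \<Rightarrow> (real^3) l2 \<Rightarrow> real l2 \<Rightarrow> bool" where
  "is_weak_div \<Omega> u g \<longleftrightarrow> g \<in> L2 \<Omega> \<and>
     (\<forall>\<phi>\<in>test_functions \<Omega>. u \<bullet> abs_l2 (grad \<phi>) = - (g \<bullet> abs_l2 \<phi>))"

definition wgrad :: "space set \<Rightarrow> real l2 \<Rightarrow> (real^3) l2" where
  "wgrad \<Omega> u = (THE g. is_weak_grad \<Omega> u g)"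

definition wcurl :: "space set \<Rightarrow> (real^3) l2 \<Rightarrow> (real^3) l2" where
  "wcurl \<Omega> u = (THE g. is_weak_curl \<Omega> u g)"

definition wdiv :: "space set \<Rightarrow> (real^3) l2 \<Rightarrow> real l2" where
  "wdiv \<Omega> u = (THE g. is_weak_div \<Omega> u g)"

definition H1 :: "space set \<Rightarrow> real l2 set" where
  "H1 \<Omega> = {u \<in> L2 \<Omega>. \<exists>g. is_weak_grad \<Omega> u g}"

definition Hcurl :: "space set \<Rightarrow> (real^3) l2 set" where
  "Hcurl \<Omega> = {u \<in> L2 \<Omega>. \<exists>g. is_weak_curl \<Omega> u g}"

definition Hdiv :: "space set \<Rightarrow> (real^3) l2 set" where
  "Hdiv \<Omega> = {u \<in> L2 \<Omega>. \<exists>g. is_weak_div \<Omega> u g}"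

text \<open>
  The spaces with vanishing (full, tangential, normal) trace, as the closures of the test functions
  in the graph norms; convergence in a graph norm is convergence of the pairs (field, derivative)
  in \<open>L\<^sup>2 \<times> L\<^sup>2\<close>.
\<close>

definition H1_0 :: "space set \<Rightarrow> real l2 set" where
  "H1_0 \<Omega> = {u \<in> H1 \<Omega>.
     (u, wgrad \<Omega> u) \<in> closure ((\<lambda>\<phi>. (abs_l2 \<phi>, abs_l2 (grad \<phi>))) ` test_functions \<Omega>)}"

definition Hcurl_0 :: "space set \<Rightarrow> (real^3) l2 set" where
  "Hcurl_0 \<Omega> = {u \<in> Hcurl \<Omega>.
     (u, wcurl \<Omega> u) \<in> closure ((\<lambda>\<phi>. (abs_l2 \<phi>, abs_l2 (curl \<phi>))) ` test_functions \<Omega>)}"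

definition Hdiv_0 :: "space set \<Rightarrow> (real^3) l2 set" where
  "Hdiv_0 \<Omega> = {u \<in> Hdiv \<Omega>.
     (u, wdiv \<Omega> u) \<in> closure ((\<lambda>\<phi>. (abs_l2 \<phi>, abs_l2 (divergence \<phi>))) ` test_functions \<Omega>)}"


section \<open>Domains and meshes\<close>

definition convex_polyhedral_domain :: "space set \<Rightarrow> bool" where
  "convex_polyhedral_domain \<Omega> \<longleftrightarrow>
     open \<Omega> \<and> \<Omega> \<noteq> {} \<and> bounded \<Omega> \<and> convex \<Omega> \<and> polyhedron (closure \<Omega>) \<and>
     \<Omega> homeomorphic (ball 0 1 :: space set)"

definition mesh_of :: "space set \<Rightarrow> space set set \<Rightarrow> bool" where
  "mesh_of \<Omega> \<T> \<longleftrightarrow> triangulation \<T> \<and> (\<forall>K\<in>\<T>. 3 simplex K) \<and> \<Union>\<T> = closure \<Omega>"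

definition mesh_size :: "space set set \<Rightarrow> real" where
  "mesh_size \<T> = Max (diameter ` \<T>)"

definition shape_regular :: "space set set set \<Rightarrow> bool" where
  "shape_regular \<F> \<longleftrightarrow>
     (\<exists>\<kappa>>0. \<forall>\<T>\<in>\<F>. \<forall>K\<in>\<T>. \<exists>x. cball x (\<kappa> * diameter K) \<subseteq> K)"

definition quasi_uniform :: "space set set set \<Rightarrow> bool" where
  "quasi_uniform \<F> \<longleftrightarrow>
     (\<exists>\<kappa>>0. \<forall>\<T>\<in>\<F>. \<forall>K\<in>\<T>. \<kappa> * mesh_size \<T> \<le> diameter K)"


section \<open>Finite element spaces\<close>

definition scalar_poly :: "nat \<Rightarrow> (space \<Rightarrow> real) set" where
  "scalar_poly r = {p. \<exists>c. \<forall>x. p x =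
     (\<Sum>(i, j, k) \<in> {(i, j, k). i + j + k \<le> r}. c i j k * x$1 ^ i * x$2 ^ j * x$3 ^ k)}"

definition vector_poly :: "nat \<Rightarrow> (space \<Rightarrow> real^3) set" where
  "vector_poly r = {p. \<forall>i. (\<lambda>x. p x $ i) \<in> scalar_poly r}"

text \<open>
  First kind of order \<open>k \<ge> 1\<close>: Nedelec (1980) and Raviart--Thomas elements, with the convention
  that order 1 is the lowest order; second kind: Nedelec (1986) and Brezzi--Douglas--Marini elements.
\<close>

datatype element_kind = First_Kind | Second_Kind

fun edge_shapes :: "element_kind \<Rightarrow> nat \<Rightarrow> (space \<Rightarrow> real^3) set" where
  "edge_shapes First_Kind k =
     {\<lambda>x. p x + cross3 x (q x) | p q. p \<in> vector_poly (k - 1) \<and> q \<in> vector_poly (k - 1)}"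
| "edge_shapes Second_Kind k = vector_poly k"

fun face_shapes :: "element_kind \<Rightarrow> nat \<Rightarrow> (space \<Rightarrow> real^3) set" where
  "face_shapes First_Kind k =
     {\<lambda>x. p x + q x *\<^sub>R x | p q. p \<in> vector_poly (k - 1) \<and> q \<in> scalar_poly (k - 1)}"
| "face_shapes Second_Kind k = vector_poly k"

definition piecewise ::
    "space set set \<Rightarrow> (space \<Rightarrow> 'b::euclidean_space) set \<Rightarrow> 'b l2 set" where
  "piecewise \<T> P = {u. \<forall>K\<in>\<T>. \<exists>p\<in>P. AE x in lborel. x \<in> K \<longrightarrow> rep_l2 u x = p x}"

text \<open>
  Conformity encodes the continuity of the degrees of freedom across faces and the boundary
  conditions.
\<close>

definition lagrange_space :: "nat \<Rightarrow> space set \<Rightarrow> space set set \<Rightarrow> real l2 set" where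
  "lagrange_space r \<Omega> \<T> = H1_0 \<Omega> \<inter> piecewise \<T> (scalar_poly r)"

definition edge_space ::
    "element_kind \<Rightarrow> nat \<Rightarrow> space set \<Rightarrow> space set set \<Rightarrow> (real^3) l2 set" where
  "edge_space kd k \<Omega> \<T> = Hcurl_0 \<Omega> \<inter> piecewise \<T> (edge_shapes kd k)"

definition face_space ::
    "element_kind \<Rightarrow> nat \<Rightarrow> space set \<Rightarrow> space set set \<Rightarrow> (real^3) l2 set" where
  "face_space kd k \<Omega> \<T> = Hdiv_0 \<Omega> \<inter> piecewise \<T> (face_shapes kd k)"

definition dg_space :: "nat \<Rightarrow> space set \<Rightarrow> space set set \<Rightarrow> real l2 set" where
  "dg_space m \<Omega> \<T> = L2_mean_zero \<Omega> \<inter> piecewise \<T> (scalar_poly m)"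

definition exact_sequence ::
    "space set \<Rightarrow> real l2 set \<Rightarrow> (real^3) l2 set \<Rightarrow> (real^3) l2 set \<Rightarrow> real l2 set \<Rightarrow> bool" where
  "exact_sequence \<Omega> S U V W \<longleftrightarrow>
     {\<tau> \<in> S. wgrad \<Omega> \<tau> = 0} = {0} \<and>
     wgrad \<Omega> ` S = {u \<in> U. wcurl \<Omega> u = 0} \<and>
     wcurl \<Omega> ` U = {v \<in> V. wdiv \<Omega> v = 0} \<and>
     wdiv \<Omega> ` V = W"


section \<open>Operators into dual spaces\<close>

text \<open>
  A functional on a finite dimensional space \<open>X\<close> is an extensional function on \<open>X\<close>, so an operator
  \<open>Y \<rightarrow> X'\<close> maps \<open>y\<close> to \<open>\<lambda>x\<in>X. \<langle>T y, x\<rangle>\<close>.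
\<close>

definition mass :: "'a::real_inner set \<Rightarrow> 'a \<Rightarrow> 'a \<Rightarrow> real" where
  "mass X \<sigma> = (\<lambda>\<tau>\<in>X. \<sigma> \<bullet> \<tau>)"

definition transposed :: "'b set \<Rightarrow> ('b \<Rightarrow> 'a \<Rightarrow> real) \<Rightarrow> 'a \<Rightarrow> 'b \<Rightarrow> real" where
  "transposed Y T x = (\<lambda>y\<in>Y. T y x)"

definition dual_add :: "'a set \<Rightarrow> ('a \<Rightarrow> real) \<Rightarrow> ('a \<Rightarrow> real) \<Rightarrow> 'a \<Rightarrow> real" where
  "dual_add X f g = (\<lambda>x\<in>X. f x + g x)"

definition dual_uminus :: "'a set \<Rightarrow> ('a \<Rightarrow> real) \<Rightarrow> 'a \<Rightarrow> real" where
  "dual_uminus X f = (\<lambda>x\<in>X. - f x)"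

text \<open>
  In block notation, with \<open>M : X \<rightarrow> X'\<close>, \<open>D : Y \<rightarrow> X'\<close>, \<open>E : X \<rightarrow> Y'\<close> and \<open>K : Y \<rightarrow> Y'\<close>:
  \<open>schur\<close> is \<open>E M^-1 D + K\<close>, \<open>saddle\<close> is \<open>((-M, D), (E, K))\<close>, and \<open>block_diag_inv\<close> is
  \<open>diag (M^-1, A^-1)\<close>. Inverses \<open>X' \<rightarrow> X\<close> are taken with \<open>the_inv_into X\<close>; they are meaningful because
  the mass and Schur forms used below are symmetric positive definite (for the latter by exactness
  of the sequence), hence bijections onto the dual spaces.
\<close>

definition schur ::
    "'a set \<Rightarrow> 'b set \<Rightarrow> ('a \<Rightarrow> 'a \<Rightarrow> real) \<Rightarrow> ('b \<Rightarrow> 'a \<Rightarrow> real) \<Rightarrow> ('a \<Rightarrow> 'b \<Rightarrow> real) \<Rightarrow>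
     ('b \<Rightarrow> 'b \<Rightarrow> real) \<Rightarrow> 'b \<Rightarrow> 'b \<Rightarrow> real" where
  "schur X Y M D E K u = dual_add Y (E (the_inv_into X M (D u))) (K u)"

definition saddle ::
    "'a set \<Rightarrow> 'b set \<Rightarrow> ('a \<Rightarrow> 'a \<Rightarrow> real) \<Rightarrow> ('b \<Rightarrow> 'a \<Rightarrow> real) \<Rightarrow> ('a \<Rightarrow> 'b \<Rightarrow> real) \<Rightarrow>
     ('b \<Rightarrow> 'b \<Rightarrow> real) \<Rightarrow> 'a \<times> 'b \<Rightarrow> ('a \<Rightarrow> real) \<times> ('b \<Rightarrow> real)" where
  "saddle X Y M D E K = (\<lambda>(\<sigma>, u).
     (dual_add X (dual_uminus X (M \<sigma>)) (D u), dual_add Y (E \<sigma>) (K u)))"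

definition block_diag_inv ::
    "'a set \<Rightarrow> 'b set \<Rightarrow> ('a \<Rightarrow> 'a \<Rightarrow> real) \<Rightarrow> ('b \<Rightarrow> 'b \<Rightarrow> real) \<Rightarrow>
     ('a \<Rightarrow> real) \<times> ('b \<Rightarrow> real) \<Rightarrow> 'a \<times> 'b" where
  "block_diag_inv X Y M A = (\<lambda>(f, g). (the_inv_into X M f, the_inv_into Y A g))"

definition energy_norm :: "('a \<Rightarrow> 'a \<Rightarrow> real) \<Rightarrow> 'a \<Rightarrow> real" where
  "energy_norm T x = sqrt (T x x)"

definition product_norm ::
    "('a \<Rightarrow> 'a \<Rightarrow> real) \<Rightarrow> ('b \<Rightarrow> 'b \<Rightarrow> real) \<Rightarrow> 'a \<times> 'b \<Rightarrow> real" where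
  "product_norm M A = (\<lambda>(\<sigma>, u). energy_norm M \<sigma> + energy_norm A u)"

text \<open>Extended-valued, so that an unbounded operator has norm \<open>\<infinity>\<close>.\<close>

definition operator_norm :: "'a::zero set \<Rightarrow> ('a \<Rightarrow> real) \<Rightarrow> ('a \<Rightarrow> 'a) \<Rightarrow> ennreal" where
  "operator_norm X N T = (SUP x\<in>X - {0}. ennreal (N (T x) / N x))"


subsection \<open>Curl case\<close>

definition B_curl :: "space set \<Rightarrow> real l2 set \<Rightarrow> (real^3) l2 \<Rightarrow> real l2 \<Rightarrow> real" where
  "B_curl \<Omega> S u = (\<lambda>\<tau>\<in>S. u \<bullet> wgrad \<Omega> \<tau>)"

definition curl_curl :: "space set \<Rightarrow> (real^3) l2 set \<Rightarrow> (real^3) l2 \<Rightarrow> (real^3) l2 \<Rightarrow> real" where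
  "curl_curl \<Omega> U u = (\<lambda>v\<in>U. wcurl \<Omega> u \<bullet> wcurl \<Omega> v)"

definition L_c where
  "L_c \<Omega> S U = saddle S U (mass S) (B_curl \<Omega> S) (transposed U (B_curl \<Omega> S)) (curl_curl \<Omega> U)"

definition A_c where
  "A_c \<Omega> S U = schur S U (mass S) (B_curl \<Omega> S) (transposed U (B_curl \<Omega> S)) (curl_curl \<Omega> U)"

definition P_c where
  "P_c \<Omega> S U = block_diag_inv S U (mass S) (A_c \<Omega> S U)"

definition norm_c where
  "norm_c \<Omega> S U = product_norm (mass S) (A_c \<Omega> S U)"


subsection \<open>Div case\<close>

definition C_div :: "space set \<Rightarrow> (real^3) l2 set \<Rightarrow> (real^3) l2 \<Rightarrow> (real^3) l2 \<Rightarrow> real" where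
  "C_div \<Omega> V \<sigma> = (\<lambda>v\<in>V. wcurl \<Omega> \<sigma> \<bullet> v)"

definition div_div :: "space set \<Rightarrow> (real^3) l2 set \<Rightarrow> (real^3) l2 \<Rightarrow> (real^3) l2 \<Rightarrow> real" where
  "div_div \<Omega> V u = (\<lambda>v\<in>V. wdiv \<Omega> u \<bullet> wdiv \<Omega> v)"

definition L_d where
  "L_d \<Omega> U V = saddle U V (mass U) (transposed U (C_div \<Omega> V)) (C_div \<Omega> V) (div_div \<Omega> V)"

definition A_d where
  "A_d \<Omega> U V = schur U V (mass U) (transposed U (C_div \<Omega> V)) (C_div \<Omega> V) (div_div \<Omega> V)"

definition P_d where
  "P_d \<Omega> U V = block_diag_inv U V (mass U) (A_d \<Omega> U V)"

definition norm_d where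
  "norm_d \<Omega> U V = product_norm (mass U) (A_d \<Omega> U V)"

end

theory Submission
  imports Defs
begin

text \<open>
  Both block systems have the form \<open>((-M, D), (E, K))\<close>, where \<open>E\<close> is the transpose of \<open>D\<close>. Put \<open>G = M^-1 D\<close>,
  so that the Schur complement is \<open>A u v = G u \<bullet> G v + K u v\<close>. The equation \<open>P L (\<sigma>, u) = (f, g)\<close> says
  \<open>f = G u - \<sigma>\<close> and \<open>A g v = \<sigma> \<bullet> G v + K u v\<close> for all \<open>v\<close>. Inserting \<open>\<sigma> = G u - f\<close> into the second
  condition gives

    \<open>\<sigma> = G u - f\<close>   and   \<open>A u v = A g v + f \<bullet> G v\<close>   for all \<open>v\<close>,

  a triangular system. It is uniquely solvable for \<open>(\<sigma>, u)\<close> because \<open>A\<close> is definite, so \<open>P L\<close> is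
  bijective. Since \<open>norm (G v)\<close> is at most the energy norm of \<open>v\<close>, the energy norms of \<open>u\<close> and \<open>g\<close> differ
  by at most \<open>norm f\<close>, and the triangle inequality for \<open>\<sigma> = G u - f\<close> bounds each of the pairs \<open>(\<sigma>, u)\<close> and
  \<open>(f, g)\<close> by three times the other. The Schur complement norm absorbs all dependence on the mesh, and
  the constant 3 is absolute. This is the content of the locale \<open>saddle_problem\<close>, whose main result is
  \<open>uniform_preconditioner\<close>.

  To apply it, three facts about the finite element spaces are required. They are subspaces on which
  \<open>wgrad\<close>, \<open>wcurl\<close> and \<open>wdiv\<close> are linear: weak derivatives are unique by the fundamental lemma of the
  calculus of variations (\<open>l2_eq_0_if_orthogonal_to_test_functions\<close>), proved with explicit smooth cut-off
  functions. They are finite dimensional (\<open>finite_dimensional_piecewise\<close>), so that functionals are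
  represented by the definite forms \<open>M\<close> and \<open>A\<close> and the inverses in \<open>P\<close> and \<open>A\<close> are genuine. Finally, \<open>A\<close> is
  definite by exactness of the sequence: if \<open>A u u = 0\<close>, then \<open>K u u = 0\<close> puts \<open>u\<close> into the range of
  the preceding differential operator, and \<open>D u = 0\<close> says that \<open>u\<close> is orthogonal to this range.
\<close>

section \<open>Symmetric positive forms on finite dimensional spaces\<close>

definition linear_form_on :: "'a::real_vector set \<Rightarrow> ('a \<Rightarrow> real) \<Rightarrow> bool" where
  "linear_form_on Y f \<longleftrightarrow>
     (\<forall>x\<in>Y. \<forall>y\<in>Y. f (x + y) = f x + f y) \<and> (\<forall>c. \<forall>x\<in>Y. f (c *\<^sub>R x) = c * f x)"

lemma linear_form_onI:
  assumes "\<And>x y. x \<in> Y \<Longrightarrow> y \<in> Y \<Longrightarrow> f (x + y) = f x + f y"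
    and "\<And>c x. x \<in> Y \<Longrightarrow> f (c *\<^sub>R x) = c * f x"
  shows "linear_form_on Y f"
  using assms by (simp add: linear_form_on_def)

lemma linear_form_on_add: "linear_form_on Y f \<Longrightarrow> x \<in> Y \<Longrightarrow> y \<in> Y \<Longrightarrow> f (x + y) = f x + f y"
  and linear_form_on_scale: "linear_form_on Y f \<Longrightarrow> x \<in> Y \<Longrightarrow> f (c *\<^sub>R x) = c * f x"
  by (simp_all add: linear_form_on_def)

lemma linear_form_on_diff:
  assumes "subspace Y" "linear_form_on Y f" "x \<in> Y" "y \<in> Y"
  shows "f (x - y) = f x - f y"
  using linear_form_on_add[of Y f x "(-1) *\<^sub>R y"] linear_form_on_scale[of Y f y "-1"] assms
    subspace_scale[of Y y "-1"] by simp

lemma linear_forms_eq_on_span: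
  assumes Y: "subspace Y" and f: "linear_form_on Y f" and g: "linear_form_on Y g"
    and F: "F \<subseteq> Y" and eq: "\<And>x. x \<in> F \<Longrightarrow> f x = g x" and x: "x \<in> span F"
  shows "f x = g x"
proof -
  have "span F \<subseteq> {x \<in> Y. f x = g x}"
  proof (rule span_minimal)
    have "f 0 = 0" "g 0 = 0"
      using linear_form_on_scale[OF f, of _ 0] linear_form_on_scale[OF g, of _ 0] subspace_0[OF Y]
      by (metis mult_zero_left scaleR_zero_left)+
    then show "subspace {x \<in> Y. f x = g x}"
      using Y f g by (auto simp: subspace_def linear_form_on_def)
  qed (use F eq in auto)
  with x show ?thesis by auto
qed

text \<open>
  The forms act on subspaces only, since the weak derivatives in them are meaningful only there.
\<close>

locale positive_form =
  fixes Y :: "'a::real_vector set" and a :: "'a \<Rightarrow> 'a \<Rightarrow> real"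
  assumes subspace: "subspace Y"
    and linear: "\<And>u. u \<in> Y \<Longrightarrow> linear_form_on Y (a u)"
    and sym: "\<And>u v. u \<in> Y \<Longrightarrow> v \<in> Y \<Longrightarrow> a u v = a v u"
    and nonneg: "\<And>u. u \<in> Y \<Longrightarrow> a u u \<ge> 0"
    and definite: "\<And>u. u \<in> Y \<Longrightarrow> a u u = 0 \<Longrightarrow> u = 0"
begin

lemma linear_left: "v \<in> Y \<Longrightarrow> linear_form_on Y (\<lambda>u. a u v)"
  using linear sym subspace
  by (intro linear_form_onI) (simp_all add: subspace_add subspace_scale linear_form_on_def)

lemma cauchy_schwarz:
  assumes u: "u \<in> Y" and v: "v \<in> Y"
  shows "\<bar>a u v\<bar> \<le> sqrt (a u u) * sqrt (a v v)"
proof (cases "v = 0")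
  case True
  then show ?thesis
    using linear_form_on_scale[OF linear[OF u] v, of 0] nonneg[OF u] nonneg[OF v] by simp
next
  case False
  then have pos: "a v v > 0" using definite[OF v] nonneg[OF v] by force
  \<comment> \<open>the component of \<open>u\<close> orthogonal to \<open>v\<close>, scaled by \<open>a v v\<close> to avoid the division\<close>
  define p q where "p = a v v *\<^sub>R u" and "q = a u v *\<^sub>R v"
  have pq: "p \<in> Y" "q \<in> Y" "p - q \<in> Y"
    using u v subspace by (auto simp: p_def q_def subspace_scale subspace_diff)
  have sc: "a (c *\<^sub>R x) y = c * a x y" "a x (c *\<^sub>R y) = c * a x y" if "x \<in> Y" "y \<in> Y" for c x y
    using linear_form_on_scale[OF linear_left] linear_form_on_scale[OF linear] that by auto
  have "0 \<le> a (p - q) (p - q)" using nonneg pq by simp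
  also have "\<dots> = a p p - 2 * a p q + a q q"
    using linear_form_on_diff[OF subspace linear, of "p - q" p q]
      linear_form_on_diff[OF subspace linear_left, of p p q]
      linear_form_on_diff[OF subspace linear_left, of q p q] sym[of p q] pq by simp
  also have "\<dots> = a v v * (a v v * a u u - (a u v)\<^sup>2)"
    using u v by (simp add: p_def q_def sc subspace_scale[OF subspace] power2_eq_square algebra_simps)
  finally have "(a u v)\<^sup>2 \<le> a v v * a u u"
    using pos by (simp add: zero_le_mult_iff)
  then have "sqrt ((a u v)\<^sup>2) \<le> sqrt (a v v * a u u)" by (rule real_sqrt_le_mono)
  then show ?thesis by (simp add: real_sqrt_mult mult.commute)
qed

text \<open>
  The solution \<open>z\<close> of \<open>a z v = f v\<close> is bounded by the dual norm \<open>C\<close> of \<open>f\<close>: testing with \<open>v = z\<close> gives the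
  last assumption.
\<close>

lemma energy_le_dual_bound:
  assumes z: "z \<in> Y" and C: "0 \<le> C" and bound: "a z z \<le> C * sqrt (a z z)"
  shows "sqrt (a z z) \<le> C"
proof (cases "a z z = 0")
  case False
  then have "sqrt (a z z) > 0" using nonneg[OF z] by simp
  moreover have "sqrt (a z z) * sqrt (a z z) \<le> C * sqrt (a z z)"
    using bound nonneg[OF z] by simp
  ultimately show ?thesis by (metis mult_le_cancel_right_pos)
qed (use C in simp)

lemma unique_representer:
  assumes "u \<in> Y" "w \<in> Y" "\<And>v. v \<in> Y \<Longrightarrow> a u v = a w v"
  shows "u = w"
proof -
  have d: "u - w \<in> Y" using assms subspace by (simp add: subspace_diff)
  then have "a (u - w) (u - w) = 0"
    using linear_form_on_diff[OF subspace linear_left[OF d]] assms by simp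
  then show ?thesis using definite[OF d] by simp
qed

text \<open>
  Gram--Schmidt on representing vectors: a functional represented on \<open>span F\<close> by \<open>u\<close> is
  represented on \<open>span (insert e F)\<close> after adding to \<open>u\<close> a multiple of the component \<open>w\<close> of \<open>e\<close>
  that is \<open>a\<close>-orthogonal to \<open>F\<close>; the projection \<open>e - w\<close> is itself obtained by representing the
  functional \<open>a e\<close>.
\<close>

lemma representation_on_finite:
  assumes "finite F" "F \<subseteq> Y" "linear_form_on Y f"
  shows "\<exists>u \<in> span F. \<forall>v\<in>F. a u v = f v"
  using assms
proof (induction F arbitrary: f rule: finite_induct)
  case empty
  then show ?case by auto
next
  case (insert e F)
  have e: "e \<in> Y" and F: "F \<subseteq> Y" using insert.prems by auto
  have FY: "span F \<subseteq> Y" using span_minimal[OF F subspace] .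
  obtain u where u: "u \<in> span F" "\<And>v. v \<in> F \<Longrightarrow> a u v = f v"
    using insert.IH[OF F insert.prems(2)] by blast
  obtain p where p: "p \<in> span F" "\<And>v. v \<in> F \<Longrightarrow> a p v = a e v"
    using insert.IH[OF F linear[OF e]] by blast
  have uY: "u \<in> Y" and pY: "p \<in> Y" using u p FY by auto
  define w where "w = e - p"
  have wY: "w \<in> Y" using e pY subspace by (simp add: w_def subspace_diff)
  have w_orth: "a w v = 0" if "v \<in> F" for v
    using linear_form_on_diff[OF subspace linear_left[of v] e pY] that F p by (auto simp: w_def)
  have wp: "a w p = 0"
  proof -
    have "linear_form_on Y (\<lambda>_. 0)" by (simp add: linear_form_on_def)
    from linear_forms_eq_on_span[OF subspace linear[OF wY] this F w_orth p(1)] show ?thesis by simp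
  qed
  have we: "a w e = a w w"
    using linear_form_on_diff[OF subspace linear[OF wY] e pY] wp by (simp add: w_def)
  show ?case
  proof (cases "w = 0")
    case True
    then have "a u e = f e"
      using linear_forms_eq_on_span[OF subspace linear[OF uY] insert.prems(2) F u(2) p(1)]
      by (simp add: w_def)
    with u show ?thesis using span_mono[of F "insert e F"] by auto
  next
    case False
    then have nz: "a w w \<noteq> 0" using definite[OF wY] by blast
    define t where "t = (f e - a u e) / a w w"
    have tw: "t *\<^sub>R w \<in> Y" using wY subspace by (simp add: subspace_scale)
    have eq: "a (u + t *\<^sub>R w) v = a u v + t * a w v" if "v \<in> Y" for v
      using linear_form_on_add[OF linear_left[OF that] uY tw]
        linear_form_on_scale[OF linear_left[OF that] wY] by simp
    have "a (u + t *\<^sub>R w) v = f v" if "v \<in> insert e F" for v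
      using that eq[of v] e F u(2) w_orth we nz by (auto simp: t_def)
    moreover have "u + t *\<^sub>R w \<in> span (insert e F)"
      unfolding w_def using u p span_mono[of F "insert e F"]
      by (intro span_add span_scale span_diff) (auto intro: span_base)
    ultimately show ?thesis by blast
  qed
qed

lemma representation:
  assumes fin: "finite F" "Y \<subseteq> span F" and f: "linear_form_on Y f"
  shows "\<exists>u\<in>Y. \<forall>v\<in>Y. a u v = f v"
proof -
  obtain B where B: "B \<subseteq> Y" "independent B" "Y \<subseteq> span B"
    using maximal_independent_subset[of Y] by blast
  have "finite B" using independent_span_bound[OF fin(1) B(2)] B(1) fin(2) by blast
  then obtain u where u: "u \<in> span B" "\<And>v. v \<in> B \<Longrightarrow> a u v = f v"
    using representation_on_finite[OF _ B(1) f] by blast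
  then have uY: "u \<in> Y" using span_minimal[OF B(1) subspace] by blast
  then show ?thesis
    using linear_forms_eq_on_span[OF subspace linear[OF uY] f B(1) u(2)] B(3) by blast
qed

end

section \<open>Saddle point problems with a Schur complement preconditioner\<close>

text \<open>
  The common form of both problems. The bilinear forms are read off from the operators: \<open>D u \<tau>\<close>
  couples the two spaces, and \<open>K u v\<close> is the form of the lower right block. Extensionality makes an
  operator value equal to a functional as soon as both agree on the space. Finite spanning sets give
  the Riesz representation, and the last assumption is what makes the Schur complement definite.
\<close>

locale saddle_problem =
  fixes X :: "'a::real_inner set" and Y :: "'b::real_vector set"
    and D :: "'b \<Rightarrow> 'a \<Rightarrow> real" and E :: "'a \<Rightarrow> 'b \<Rightarrow> real" and K :: "'b \<Rightarrow> 'b \<Rightarrow> real"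
    and FX :: "'a set" and FY :: "'b set"
  assumes X: "subspace X" "finite FX" "X \<subseteq> span FX"
    and Y: "subspace Y" "finite FY" "Y \<subseteq> span FY"
    and D_ext: "\<And>u. u \<in> Y \<Longrightarrow> D u \<in> extensional X"
    and E_ext: "\<And>\<sigma>. \<sigma> \<in> X \<Longrightarrow> E \<sigma> \<in> extensional Y"
    and K_ext: "\<And>u. u \<in> Y \<Longrightarrow> K u \<in> extensional Y"
    and E_eq_D: "\<And>\<sigma> u. \<sigma> \<in> X \<Longrightarrow> u \<in> Y \<Longrightarrow> E \<sigma> u = D u \<sigma>"
    and D_linear: "\<And>u. u \<in> Y \<Longrightarrow> linear_form_on X (D u)"
    and E_linear: "\<And>\<sigma>. \<sigma> \<in> X \<Longrightarrow> linear_form_on Y (E \<sigma>)"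
    and K_linear: "\<And>u. u \<in> Y \<Longrightarrow> linear_form_on Y (K u)"
    and K_sym: "\<And>u v. u \<in> Y \<Longrightarrow> v \<in> Y \<Longrightarrow> K u v = K v u"
    and K_nonneg: "\<And>u. u \<in> Y \<Longrightarrow> K u u \<ge> 0"
    and nondegenerate: "\<And>u. u \<in> Y \<Longrightarrow> K u u = 0 \<Longrightarrow> (\<And>\<tau>. \<tau> \<in> X \<Longrightarrow> D u \<tau> = 0) \<Longrightarrow> u = 0"
begin

definition "A = schur X Y (mass X) D E K"
definition "L = saddle X Y (mass X) D E K"
definition "P = block_diag_inv X Y (mass X) A"
definition "N = product_norm (mass X) A"

text \<open>The operator \<open>M^-1 D\<close>, adjoint to \<open>E\<close> with respect to the inner product of \<open>X\<close>.\<close>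

definition G :: "'b \<Rightarrow> 'a" where "G u = the_inv_into X (mass X) (D u)"

sublocale mass: positive_form X "mass X"
  by unfold_locales
     (auto simp: X mass_def linear_form_on_def inner_add_right inner_commute subspace_add subspace_scale)

lemma mass_inj: "inj_on (mass X) X"
proof (rule inj_onI)
  fix \<sigma> \<tau> assume "\<sigma> \<in> X" "\<tau> \<in> X" "mass X \<sigma> = mass X \<tau>"
  then show "\<sigma> = \<tau>" by (intro mass.unique_representer) auto
qed

lemma inv_mass:
  assumes f: "linear_form_on X f" "f \<in> extensional X"
  shows "the_inv_into X (mass X) f \<in> X \<and> (\<forall>\<tau>\<in>X. the_inv_into X (mass X) f \<bullet> \<tau> = f \<tau>)"
proof -
  obtain \<sigma> where \<sigma>: "\<sigma> \<in> X" "\<forall>\<tau>\<in>X. mass X \<sigma> \<tau> = f \<tau>"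
    using mass.representation[OF X(2,3) f(1)] by blast
  then have "mass X \<sigma> = f"
    using f(2) by (intro extensionalityI[of _ X]) (auto simp: mass_def)
  then have "the_inv_into X (mass X) f = \<sigma>"
    using \<sigma> the_inv_into_f_f[OF mass_inj] by blast
  with \<sigma> show ?thesis by (auto simp: mass_def)
qed

lemma G_in: "u \<in> Y \<Longrightarrow> G u \<in> X"
  and G_inner: "u \<in> Y \<Longrightarrow> \<tau> \<in> X \<Longrightarrow> G u \<bullet> \<tau> = D u \<tau>"
  using inv_mass[OF D_linear D_ext] by (auto simp: G_def)

lemma E_eq_G: "\<sigma> \<in> X \<Longrightarrow> u \<in> Y \<Longrightarrow> E \<sigma> u = \<sigma> \<bullet> G u"
  by (simp add: E_eq_D G_inner[symmetric] inner_commute)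

lemma A_apply: "u \<in> Y \<Longrightarrow> v \<in> Y \<Longrightarrow> A u v = G u \<bullet> G v + K u v"
  by (simp add: A_def schur_def dual_add_def G_def[symmetric] E_eq_G G_in)

lemma A_ext: "A u \<in> extensional Y"
  by (simp add: A_def schur_def dual_add_def)

sublocale schur: positive_form Y A
proof
  show "subspace Y" by (rule Y)
  fix u assume u: "u \<in> Y"
  have "G u \<bullet> G v = E (G u) v" if "v \<in> Y" for v
    using E_eq_G G_in u that by simp
  then show "linear_form_on Y (A u)"
    using E_linear[OF G_in[OF u]] K_linear[OF u] u Y(1)
    by (intro linear_form_onI)
       (simp_all add: A_apply linear_form_on_def subspace_add subspace_scale algebra_simps)
  show "A u u \<ge> 0" using u by (simp add: A_apply K_nonneg)
  show "u = 0" if "A u u = 0"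
  proof (rule nondegenerate[OF u])
    have "G u \<bullet> G u = 0 \<and> K u u = 0"
      using that u K_nonneg[OF u] inner_ge_zero[of "G u"] by (simp add: A_apply add_nonneg_eq_0_iff)
    then show "K u u = 0" "\<And>\<tau>. \<tau> \<in> X \<Longrightarrow> D u \<tau> = 0"
      using G_inner[OF u] by auto
  qed
  show "A u v = A v u" if "v \<in> Y" for v
    using u that by (simp add: A_apply K_sym inner_commute)
qed

lemma A_inj: "inj_on A Y"
proof (rule inj_onI)
  fix u v assume "u \<in> Y" "v \<in> Y" "A u = A v"
  then show "u = v" by (intro schur.unique_representer) auto
qed

lemma inv_A:
  assumes f: "linear_form_on Y f" "f \<in> extensional Y"
  shows "the_inv_into Y A f \<in> Y \<and> (\<forall>v\<in>Y. A (the_inv_into Y A f) v = f v)"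
proof -
  obtain u where u: "u \<in> Y" "\<forall>v\<in>Y. A u v = f v"
    using schur.representation[OF Y(2,3) f(1)] by blast
  then have "A u = f"
    using f(2) A_ext by (intro extensionalityI[of _ Y]) auto
  then have "the_inv_into Y A f = u"
    using u the_inv_into_f_f[OF A_inj] by blast
  with u show ?thesis by auto
qed

abbreviation energy :: "'b \<Rightarrow> real" where "energy u \<equiv> sqrt (A u u)"

lemma N_apply: "\<sigma> \<in> X \<Longrightarrow> N (\<sigma>, u) = norm \<sigma> + energy u"
  by (simp add: N_def product_norm_def energy_norm_def mass_def norm_eq_sqrt_inner)

lemma norm_G_le: "u \<in> Y \<Longrightarrow> norm (G u) \<le> energy u"
  by (simp add: norm_eq_sqrt_inner A_apply K_nonneg)

lemma inner_G_le:
  assumes v: "v \<in> Y"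
  shows "\<bar>\<sigma> \<bullet> G v\<bar> \<le> norm \<sigma> * energy v"
  using Cauchy_Schwarz_ineq2[of \<sigma> "G v"] mult_left_mono[OF norm_G_le[OF v] norm_ge_zero[of \<sigma>]]
  by linarith

text \<open>
  In the variables \<open>(f, g) = P L (\<sigma>, u)\<close>, the first block row says \<open>f = G u - \<sigma>\<close>, and the second one
  is the variational characterisation of \<open>g\<close> against the Schur complement form.
\<close>

lemma PL_eq_iff:
  assumes \<sigma>: "\<sigma> \<in> X" and u: "u \<in> Y" and f: "f \<in> X" and g: "g \<in> Y"
  shows "(P \<circ> L) (\<sigma>, u) = (f, g) \<longleftrightarrow>
     f = G u - \<sigma> \<and> (\<forall>v\<in>Y. A g v = \<sigma> \<bullet> G v + K u v)"
proof -
  have 1: "the_inv_into X (mass X) (dual_add X (dual_uminus X (mass X \<sigma>)) (D u)) = G u - \<sigma>"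
  proof -
    have "dual_add X (dual_uminus X (mass X \<sigma>)) (D u) = mass X (G u - \<sigma>)"
      using u by (auto simp: dual_add_def dual_uminus_def mass_def G_inner inner_diff_left)
    then show ?thesis
      using the_inv_into_f_f[OF mass_inj] G_in[OF u] \<sigma> X(1) by (simp add: subspace_diff)
  qed
  define F where "F = dual_add Y (E \<sigma>) (K u)"
  have F: "F \<in> extensional Y" "\<And>v. v \<in> Y \<Longrightarrow> F v = \<sigma> \<bullet> G v + K u v"
    by (auto simp: F_def dual_add_def E_eq_G \<sigma>)
  have "linear_form_on Y F"
    using E_linear[OF \<sigma>] K_linear[OF u] Y(1)
    by (auto simp: F_def dual_add_def linear_form_on_def subspace_add subspace_scale algebra_simps)
  note inv = inv_A[OF this F(1)]
  have 2: "the_inv_into Y A F = g \<longleftrightarrow> (\<forall>v\<in>Y. A g v = F v)"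
  proof
    assume "\<forall>v\<in>Y. A g v = F v"
    then show "the_inv_into Y A F = g"
      using inv g by (intro schur.unique_representer) auto
  qed (use inv in auto)
  show ?thesis
    unfolding comp_def P_def L_def block_diag_inv_def saddle_def
    using 1 2 F by (auto simp: F_def[symmetric])
qed

lemma PL_in:
  assumes \<sigma>: "\<sigma> \<in> X" and u: "u \<in> Y"
  shows "(P \<circ> L) (\<sigma>, u) \<in> X \<times> Y"
proof -
  have "linear_form_on Y (\<lambda>v\<in>Y. E \<sigma> v + K u v)"
    using E_linear[OF \<sigma>] K_linear[OF u] Y(1)
    by (auto simp: linear_form_on_def subspace_add subspace_scale algebra_simps)
  from inv_A[OF this] obtain g where g: "g \<in> Y" "\<forall>v\<in>Y. A g v = E \<sigma> v + K u v" by auto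
  then have "(P \<circ> L) (\<sigma>, u) = (G u - \<sigma>, g)"
    using \<sigma> u G_in X(1) by (subst PL_eq_iff) (auto simp: E_eq_G subspace_diff)
  then show ?thesis using g G_in[OF u] \<sigma> X(1) by (simp add: subspace_diff)
qed

text \<open>
  Eliminating \<open>\<sigma> = G u - f\<close> from the second row turns its right hand side into \<open>A u v - f \<bullet> G v\<close>.
  So the system decouples: given \<open>(f, g)\<close>, the second condition is an equation for \<open>u\<close> alone with a
  definite form, and \<open>\<sigma>\<close> follows from the first.
\<close>

lemma PL_eq_iff':
  assumes "\<sigma> \<in> X" "u \<in> Y" "f \<in> X" "g \<in> Y"
  shows "(P \<circ> L) (\<sigma>, u) = (f, g) \<longleftrightarrow>
     \<sigma> = G u - f \<and> (\<forall>v\<in>Y. A u v = A g v + f \<bullet> G v)"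
proof -
  have "f = G u - \<sigma> \<longleftrightarrow> \<sigma> = G u - f" by (auto simp: algebra_simps)
  moreover have "A g v = \<sigma> \<bullet> G v + K u v \<longleftrightarrow> A u v = A g v + f \<bullet> G v"
    if "\<sigma> = G u - f" "v \<in> Y" for v
    using that assms by (auto simp: A_apply[of u] inner_diff_left)
  ultimately show ?thesis using assms unfolding PL_eq_iff[OF assms] by blast
qed

lemma PL_bij: "bij_betw (P \<circ> L) (X \<times> Y) (X \<times> Y)"
proof (rule bij_betw_imageI)
  show "inj_on (P \<circ> L) (X \<times> Y)"
  proof (rule inj_onI, clarify)
    fix \<sigma> u \<sigma>' u'
    assume *: "\<sigma> \<in> X" "u \<in> Y" "\<sigma>' \<in> X" "u' \<in> Y" "(P \<circ> L) (\<sigma>, u) = (P \<circ> L) (\<sigma>', u')"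
    obtain f g where fg: "(P \<circ> L) (\<sigma>', u') = (f, g)" "f \<in> X" "g \<in> Y"
      using PL_in[of \<sigma>' u'] * by auto
    have 1: "\<sigma> = G u - f" "\<forall>v\<in>Y. A u v = A g v + f \<bullet> G v"
      using PL_eq_iff'[of \<sigma> u f g] fg * by auto
    have 2: "\<sigma>' = G u' - f" "\<forall>v\<in>Y. A u' v = A g v + f \<bullet> G v"
      using PL_eq_iff'[of \<sigma>' u' f g] fg * by auto
    have "u = u'" using 1 2 * by (intro schur.unique_representer) auto
    with 1 2 show "\<sigma> = \<sigma>' \<and> u = u'" by simp
  qed
  show "(P \<circ> L) ` (X \<times> Y) = X \<times> Y"
  proof (intro equalityI subsetI)
    fix z assume "z \<in> (P \<circ> L) ` (X \<times> Y)"
    then show "z \<in> X \<times> Y" using PL_in by blast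
  next
    fix z assume "z \<in> X \<times> Y"
    then obtain f g where z: "z = (f, g)" "f \<in> X" "g \<in> Y" by auto
    have "linear_form_on Y (\<lambda>v. A g v + E f v)"
      using E_linear[OF z(2)] schur.linear[OF z(3)] by (auto simp: linear_form_on_def algebra_simps)
    then obtain u where u: "u \<in> Y" "\<forall>v\<in>Y. A u v = A g v + E f v"
      using schur.representation[OF Y(2,3)] by blast
    have s: "G u - f \<in> X" using G_in[OF u(1)] z X(1) by (simp add: subspace_diff)
    have "(P \<circ> L) (G u - f, u) = z"
      unfolding z(1) using PL_eq_iff'[OF s u(1) z(2,3)] u(2) z by (auto simp: E_eq_G)
    then show "z \<in> (P \<circ> L) ` (X \<times> Y)" using s u(1) by (metis SigmaI image_eqI)
  qed
qed

text \<open>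
  Both directions of the norm equivalence rest on this estimate: the functional \<open>v \<mapsto> f \<bullet> G v\<close> has
  dual norm at most \<open>norm f\<close>, because \<open>norm (G v) \<le> energy v\<close>. It applies to the second condition of
  the decoupled system as well as to that condition solved for \<open>A g\<close>.
\<close>

lemma energy_perturbation:
  assumes u: "u \<in> Y" and w: "w \<in> Y" and eq: "\<And>v. v \<in> Y \<Longrightarrow> A u v = A w v + f \<bullet> G v"
  shows "energy u \<le> energy w + norm f"
proof (rule schur.energy_le_dual_bound[OF u])
  show "0 \<le> energy w + norm f" by (simp add: schur.nonneg w)
  have "A w u \<le> energy w * energy u" using schur.cauchy_schwarz[OF w u] by linarith
  moreover have "f \<bullet> G u \<le> norm f * energy u" using inner_G_le[OF u, of f] by linarith
  ultimately show "A u u \<le> (energy w + norm f) * energy u"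
    using eq[OF u] by (simp add: distrib_right)
qed

lemma norm_equivalence:
  assumes \<sigma>: "\<sigma> \<in> X" and u: "u \<in> Y"
  shows "N ((P \<circ> L) (\<sigma>, u)) \<le> 3 * N (\<sigma>, u)" and "N (\<sigma>, u) \<le> 3 * N ((P \<circ> L) (\<sigma>, u))"
proof -
  obtain f g where fg: "(P \<circ> L) (\<sigma>, u) = (f, g)" "f \<in> X" "g \<in> Y"
    using PL_in[OF \<sigma> u] by auto
  have s: "\<sigma> = G u - f" and eq: "\<And>v. v \<in> Y \<Longrightarrow> A u v = A g v + f \<bullet> G v"
    using PL_eq_iff'[OF \<sigma> u fg(2,3)] fg(1) by blast+
  have eq': "A g v = A u v + (- f) \<bullet> G v" if "v \<in> Y" for v using eq[OF that] by simp
  have f: "f = G u - \<sigma>" using s by simp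
  have "norm f \<le> energy u + norm \<sigma>"
    using norm_triangle_ineq4[of "G u" \<sigma>] norm_G_le[OF u] f by simp
  moreover have "energy g \<le> energy u + norm f"
    using energy_perturbation[OF fg(3) u eq'] by simp
  ultimately show "N ((P \<circ> L) (\<sigma>, u)) \<le> 3 * N (\<sigma>, u)"
    unfolding fg(1) N_apply[OF \<sigma>] N_apply[OF fg(2)] using norm_ge_zero[of \<sigma>] by argo
  have "norm \<sigma> \<le> energy u + norm f"
    using norm_triangle_ineq4[of "G u" f] norm_G_le[OF u] s by simp
  moreover have "energy u \<le> energy g + norm f"
    using energy_perturbation[OF u fg(3) eq] .
  moreover have "0 \<le> energy g" by (simp add: schur.nonneg fg)
  ultimately show "N (\<sigma>, u) \<le> 3 * N ((P \<circ> L) (\<sigma>, u))"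
    unfolding fg(1) N_apply[OF \<sigma>] N_apply[OF fg(2)] by argo
qed

lemma operator_norm_le:
  assumes "\<And>z. z \<in> X \<times> Y \<Longrightarrow> N (T z) \<le> c * N z" and "0 \<le> c"
  shows "operator_norm (X \<times> Y) N T \<le> ennreal c"
  unfolding operator_norm_def
proof (rule SUP_least)
  fix z assume z: "z \<in> X \<times> Y - {0}"
  have "N z \<ge> 0" using z by (cases z) (auto simp: N_apply schur.nonneg)
  then have "N (T z) / N z \<le> c"
    using assms(1)[of z] z \<open>0 \<le> c\<close> by (cases "N z = 0") (auto simp: divide_le_eq)
  then show "ennreal (N (T z) / N z) \<le> ennreal c" by (rule ennreal_leI)
qed

theorem uniform_preconditioner:
  "bij_betw (P \<circ> L) (X \<times> Y) (X \<times> Y) \<and>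
   operator_norm (X \<times> Y) N (P \<circ> L) \<le> ennreal 3 \<and>
   operator_norm (X \<times> Y) N (the_inv_into (X \<times> Y) (P \<circ> L)) \<le> ennreal 3"
proof (intro conjI PL_bij operator_norm_le)
  show "N ((P \<circ> L) z) \<le> 3 * N z" if "z \<in> X \<times> Y" for z
    using norm_equivalence(1) that by auto
  show "N (the_inv_into (X \<times> Y) (P \<circ> L) z) \<le> 3 * N z" if "z \<in> X \<times> Y" for z
  proof -
    define y where "y = the_inv_into (X \<times> Y) (P \<circ> L) z"
    have "y \<in> X \<times> Y" "(P \<circ> L) y = z"
      using PL_bij that unfolding y_def bij_betw_def
      by (auto intro!: the_inv_into_into f_the_inv_into_f simp del: comp_apply)
    then show ?thesis using norm_equivalence(2) by (auto simp: y_def[symmetric] simp del: comp_apply)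
  qed
qed simp_all

end

section \<open>Smooth cut-off functions\<close>

text \<open>
  The derivatives of \<open>exp (- 1 / t)\<close>, extended by \<open>0\<close> to the negative half line, are linear combinations
  of these functions. The inverse power never spoils flatness at the origin, because the exponential
  decays faster.
\<close>

definition exp_bump :: "nat \<Rightarrow> real \<Rightarrow> real" where
  "exp_bump n t = (if t > 0 then inverse t ^ n * exp (- inverse t) else 0)"

lemma exp_bump_tendsto_0: "(exp_bump n \<longlongrightarrow> 0) (at 0)"
proof -
  have "((\<lambda>t. inverse t ^ n / exp (inverse t)) \<longlongrightarrow> (0::real)) (at_right 0)"
    by (rule filterlim_compose[OF tendsto_power_div_exp_0 filterlim_inverse_at_top_right])
  moreover have "\<forall>\<^sub>F t in at_right 0. inverse t ^ n / exp (inverse t) = exp_bump n t"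
    unfolding eventually_at_filter by (auto simp: exp_bump_def exp_minus divide_inverse intro!: always_eventually)
  ultimately have "(exp_bump n \<longlongrightarrow> 0) (at_right 0)" by (rule Lim_transform_eventually)
  moreover have "\<forall>\<^sub>F t in at_left 0. 0 = exp_bump n t"
    unfolding eventually_at_filter by (auto simp: exp_bump_def intro!: always_eventually)
  then have "(exp_bump n \<longlongrightarrow> 0) (at_left 0)" by (rule Lim_transform_eventually[OF tendsto_const])
  ultimately show ?thesis by (simp add: filterlim_split_at)
qed

lemma exp_bump_derivative:
  "(exp_bump n has_real_derivative exp_bump (n + 2) t - real n * exp_bump (n + 1) t) (at t)"
proof -
  consider "t > 0" | "t < 0" | "t = 0" by linarith
  then show ?thesis
  proof cases
    case 1
    have "((\<lambda>t. inverse t ^ n * exp (- inverse t)) has_real_derivative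
        exp_bump (n + 2) t - real n * exp_bump (n + 1) t) (at t)"
    proof (cases n)
      case 0
      with 1 show ?thesis
        by (auto intro!: derivative_eq_intros simp: exp_bump_def power2_eq_square)
    next
      case (Suc m)
      have "((\<lambda>t. inverse t ^ Suc m) has_real_derivative
          (1 + real m) * (- (inverse t ^ Suc (Suc 0)) * inverse t ^ m)) (at t)"
        using DERIV_power_Suc[OF DERIV_inverse[of t], of m] 1 by simp
      from DERIV_mult[OF this DERIV_chain'[OF DERIV_minus[OF DERIV_inverse[of t]] DERIV_exp]]
      show ?thesis
        using 1 Suc by (simp add: exp_bump_def algebra_simps)
    qed
    then show ?thesis
      by (rule has_field_derivative_transform_within_open[of _ _ _ "{0<..}"])
         (use 1 in \<open>auto simp: exp_bump_def\<close>)
  next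
    case 2
    have "((\<lambda>t. 0) has_real_derivative exp_bump (n + 2) t - real n * exp_bump (n + 1) t) (at t)"
      using 2 by (simp add: exp_bump_def)
    then show ?thesis
      by (rule has_field_derivative_transform_within_open[of _ _ _ "{..<0}"])
         (use 2 in \<open>auto simp: exp_bump_def\<close>)
  next
    case 3
    have "(exp_bump (n + 1) \<longlongrightarrow> 0) (at 0)" by (rule exp_bump_tendsto_0)
    moreover have "\<forall>\<^sub>F h in at 0. exp_bump (n + 1) h = (exp_bump n (0 + h) - exp_bump n 0) / h"
      by (auto simp: exp_bump_def divide_inverse intro!: always_eventually)
    ultimately have "((\<lambda>h. (exp_bump n (0 + h) - exp_bump n 0) / h) \<longlongrightarrow> 0) (at 0)"
      by (rule Lim_transform_eventually)
    then have "(exp_bump n has_real_derivative 0) (at 0)" by (simp add: DERIV_def)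
    then show ?thesis using 3 by (simp add: exp_bump_def)
  qed
qed

text \<open>
  A class of functions that is closed under directional derivatives, hence consists of smooth
  functions by coinduction.
\<close>

inductive bump_term :: "(space \<Rightarrow> real) \<Rightarrow> bool" where
  const: "bump_term (\<lambda>x. c)"
| coord: "bump_term (\<lambda>x. x $ i)"
| add: "bump_term f \<Longrightarrow> bump_term g \<Longrightarrow> bump_term (\<lambda>x. f x + g x)"
| mult: "bump_term f \<Longrightarrow> bump_term g \<Longrightarrow> bump_term (\<lambda>x. f x * g x)"
| bump: "bump_term f \<Longrightarrow> bump_term (\<lambda>x. exp_bump n (f x))"

lemma bump_term_derivative:
  assumes "bump_term f"
  shows "\<exists>f'. (\<forall>x. (f has_derivative f' x) (at x)) \<and> (\<forall>v. bump_term (\<lambda>x. f' x v))"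
  using assms
proof induction
  case (const c)
  show ?case by (rule exI[of _ "\<lambda>x v. 0"]) (auto intro: bump_term.const)
next
  case (coord i)
  have "((\<lambda>x. x $ i) has_derivative (\<lambda>v. v $ i)) (at x)" for x :: space
    by (rule bounded_linear_imp_has_derivative) (rule bounded_linear_vec_nth)
  then show ?case by (intro exI[of _ "\<lambda>x v. v $ i"]) (auto intro: bump_term.const)
next
  case (add f g)
  then obtain f' g' where d: "\<And>x. (f has_derivative f' x) (at x)" "\<And>x. (g has_derivative g' x) (at x)"
    and b: "\<And>v. bump_term (\<lambda>x. f' x v)" "\<And>v. bump_term (\<lambda>x. g' x v)" by metis
  show ?case
    using d b by (intro exI[of _ "\<lambda>x v. f' x v + g' x v"])
      (auto intro!: derivative_eq_intros bump_term.add)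
next
  case (mult f g)
  then obtain f' g' where d: "\<And>x. (f has_derivative f' x) (at x)" "\<And>x. (g has_derivative g' x) (at x)"
    and b: "\<And>v. bump_term (\<lambda>x. f' x v)" "\<And>v. bump_term (\<lambda>x. g' x v)" by metis
  show ?case
    using d b mult.hyps by (intro exI[of _ "\<lambda>x v. f x * g' x v + f' x v * g x"])
      (auto intro!: has_derivative_mult bump_term.add bump_term.mult)
next
  case (bump f n)
  then obtain f' where d: "\<And>x. (f has_derivative f' x) (at x)"
    and b: "\<And>v. bump_term (\<lambda>x. f' x v)" by metis
  let ?q = "\<lambda>x. exp_bump (n + 2) (f x) + (- real n) * exp_bump (n + 1) (f x)"
  have "((\<lambda>x. exp_bump n (f x)) has_derivative (\<lambda>v. ?q x * f' x v)) (at x)" for x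
    using has_derivative_compose[OF d exp_bump_derivative[of n "f x", unfolded has_field_derivative_def]]
    by simp
  moreover have "bump_term (\<lambda>x. ?q x * f' x v)" for v
    by (intro bump_term.mult bump_term.add bump_term.bump bump_term.const b bump.hyps)
  ultimately show ?case by (intro exI[of _ "\<lambda>x v. ?q x * f' x v"]) auto
qed

lemma smooth_bump_term:
  assumes "bump_term f"
  shows "smooth (\<lambda>x. f x *\<^sub>R e)"
proof -
  have "\<exists>f. bump_term f \<and> h = (\<lambda>x. f x *\<^sub>R e) \<Longrightarrow> smooth h" for h
  proof (coinduction arbitrary: h rule: smooth.coinduct)
    case (smooth h)
    then obtain f where f: "bump_term f" "h = (\<lambda>x. f x *\<^sub>R e)" by blast
    obtain f' where d: "\<And>x. (f has_derivative f' x) (at x)"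
      and b: "\<And>v. bump_term (\<lambda>x. f' x v)" using bump_term_derivative[OF f(1)] by blast
    have D: "(h has_derivative (\<lambda>v. f' x v *\<^sub>R e)) (at x)" for x
      unfolding f(2) by (rule has_derivative_scaleR_left[OF d])
    then have "frechet_derivative h (at x) v = f' x v *\<^sub>R e" for x v
      using frechet_derivative_at[OF D] by metis
    then show ?case using D b unfolding differentiable_def by fastforce
  qed
  with assms show ?thesis by blast
qed

text \<open>
  The profile \<open>exp (- 1 / t)\<close> tends to \<open>1\<close> as \<open>t\<close> grows, so the steepening factor \<open>Suc n\<close> makes the cut-offs
  converge to the indicator of the open box while their support does not leave its closure.
\<close>

definition box_cutoff :: "nat \<Rightarrow> space \<Rightarrow> space \<Rightarrow> space \<Rightarrow> real" where
  "box_cutoff n a b x =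
     (\<Prod>i\<in>UNIV. exp_bump 0 (real (Suc n) * (x$i - a$i)) * exp_bump 0 (real (Suc n) * (b$i - x$i)))"

lemma bump_term_prod:
  assumes "finite I" "\<And>i. i \<in> I \<Longrightarrow> bump_term (f i)"
  shows "bump_term (\<lambda>x. \<Prod>i\<in>I. f i x)"
  using assms by induction (auto intro: bump_term.const bump_term.mult)

lemma bump_term_box_cutoff: "bump_term (box_cutoff n a b)"
proof -
  have "bump_term (\<lambda>x. exp_bump 0 (real (Suc n) * (x$i - a$i)))"
    "bump_term (\<lambda>x. exp_bump 0 (real (Suc n) * (b$i - x$i)))" for i
  proof -
    have "bump_term (\<lambda>x. exp_bump 0 (real (Suc n) * (x$i + (- a$i))))"
      "bump_term (\<lambda>x. exp_bump 0 (real (Suc n) * (b$i + (-1) * x$i)))"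
      by (intro bump_term.intros)+
    then show "bump_term (\<lambda>x. exp_bump 0 (real (Suc n) * (x$i - a$i)))"
    "bump_term (\<lambda>x. exp_bump 0 (real (Suc n) * (b$i - x$i)))" by simp_all
  qed
  then show ?thesis
    unfolding box_cutoff_def[abs_def] by (intro bump_term_prod bump_term.mult) auto
qed

lemma exp_bump_0_bounds: "0 \<le> exp_bump 0 t" "exp_bump 0 t \<le> 1"
  by (auto simp: exp_bump_def)

lemma box_cutoff_bounds: "0 \<le> box_cutoff n a b x" "box_cutoff n a b x \<le> 1"
  unfolding box_cutoff_def
  by (auto intro!: prod_nonneg prod_le_1 mult_le_one mult_nonneg_nonneg exp_bump_0_bounds)

lemma box_cutoff_outside: "x \<notin> box a b \<Longrightarrow> box_cutoff n a b x = 0"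
  unfolding box_cutoff_def mem_box_cart exp_bump_def
  by (simp add: zero_less_mult_iff)

lemma box_cutoff_tendsto: "(\<lambda>n. box_cutoff n a b x) \<longlonglongrightarrow> indicator (box a b) x"
proof (cases "x \<in> box a b")
  case True
  have lim: "(\<lambda>n. exp_bump 0 (real (Suc n) * t)) \<longlonglongrightarrow> 1" if "t > 0" for t
  proof -
    have "(\<lambda>n. exp (- (inverse (real (Suc n)) * inverse t))) \<longlonglongrightarrow> exp (- (0 * inverse t))"
      by (intro tendsto_intros LIMSEQ_inverse_real_of_nat)
    moreover have "exp_bump 0 (real (Suc n) * t) = exp (- (inverse (real (Suc n)) * inverse t))" for n
      using that by (simp add: exp_bump_def del: of_nat_Suc)
    ultimately show ?thesis by (simp del: of_nat_Suc)
  qed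
  have "(\<lambda>n. box_cutoff n a b x) \<longlonglongrightarrow> (\<Prod>i\<in>(UNIV::3 set). 1 * 1)"
    unfolding box_cutoff_def using True by (intro tendsto_prod tendsto_mult lim) (auto simp: mem_box_cart)
  with True show ?thesis by simp
qed (simp add: box_cutoff_outside)

lemma test_functions_support:
  assumes h: "smooth h" and S: "compact S" "S \<subseteq> \<Omega>" and zero: "\<And>x. x \<notin> S \<Longrightarrow> h x = 0"
  shows "h \<in> test_functions \<Omega>"
proof -
  have *: "closure {x. h x \<noteq> 0} \<subseteq> S"
    using zero by (intro closure_minimal compact_imp_closed S) auto
  then have "compact (closure {x. h x \<noteq> 0})"
    using compact_Int_closed[OF S(1) closed_closure] by (metis Int_absorb1)
  with * h S show ?thesis by (auto simp: test_functions_def)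
qed

lemma box_cutoff_test_function:
  assumes "cbox a b \<subseteq> \<Omega>"
  shows "(\<lambda>x. box_cutoff n a b x *\<^sub>R e) \<in> test_functions \<Omega>"
proof (rule test_functions_support[OF _ compact_cbox assms])
  show "smooth (\<lambda>x. box_cutoff n a b x *\<^sub>R e)"
    by (intro smooth_bump_term bump_term_box_cutoff)
  show "box_cutoff n a b x *\<^sub>R e = 0" if "x \<notin> cbox a b" for x
    using that box_cutoff_outside box_subset_cbox by fastforce
qed

section \<open>Square integrable classes\<close>

lemma l2_rel_iff: "l2_rel f f \<longleftrightarrow> square_integrable f"
  by (simp add: l2_rel_def)

lemma square_integrable_rep: "square_integrable (rep_l2 u)"
  using Quotient3_rep_reflp[OF Quotient3_l2, of u] by (simp add: l2_rel_iff)

lemma abs_rep_l2: "abs_l2 (rep_l2 u) = u"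
  by (rule Quotient3_abs_rep[OF Quotient3_l2])

lemma rep_abs_l2:
  assumes "square_integrable f" shows "AE x in lborel. rep_l2 (abs_l2 f) x = f x"
  using rep_abs_rsp_left[OF Quotient3_l2, of f f] assms by (simp add: l2_rel_def)

lemma abs_l2_eqI:
  assumes "square_integrable f" "square_integrable g" "AE x in lborel. f x = g x"
  shows "abs_l2 f = abs_l2 g"
  using Quotient3_rel_abs[OF Quotient3_l2, of f g] assms by (simp add: l2_rel_def)

lemma l2_eqI: "AE x in lborel. rep_l2 u x = rep_l2 v x \<Longrightarrow> u = v"
  using abs_l2_eqI[OF square_integrable_rep square_integrable_rep, of u v] by (simp add: abs_rep_l2)

lemma abs_l2_add: "square_integrable f \<Longrightarrow> square_integrable g \<Longrightarrow> abs_l2 (\<lambda>x. f x + g x) = abs_l2 f + abs_l2 g"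
  by (simp add: plus_l2.abs_eq l2_rel_iff)

lemma abs_l2_scaleR: "square_integrable f \<Longrightarrow> abs_l2 (\<lambda>x. c *\<^sub>R f x) = c *\<^sub>R abs_l2 f"
  by (simp add: scaleR_l2.abs_eq l2_rel_iff)

lemma abs_l2_inner: "square_integrable f \<Longrightarrow> square_integrable g \<Longrightarrow> abs_l2 f \<bullet> abs_l2 g = (LINT x|lborel. f x \<bullet> g x)"
  by (simp add: inner_l2.abs_eq l2_rel_iff)

lemma rep_l2_add: "AE x in lborel. rep_l2 (u + v) x = rep_l2 u x + rep_l2 v x"
  using rep_abs_l2[OF square_integrable_add[OF square_integrable_rep square_integrable_rep]]
  by (simp add: abs_l2_add square_integrable_rep abs_rep_l2)

lemma rep_l2_scaleR: "AE x in lborel. rep_l2 (c *\<^sub>R u) x = c *\<^sub>R rep_l2 u x"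
  using rep_abs_l2[OF square_integrable_scaleR[OF square_integrable_rep]]
  by (simp add: abs_l2_scaleR square_integrable_rep abs_rep_l2)

lemma rep_l2_0: "AE x in lborel. rep_l2 0 x = 0"
  using rep_l2_scaleR[of 0 0] by simp

lemma subspace_L2: "subspace (L2 \<Omega> :: 'a::euclidean_space l2 set)"
  unfolding subspace_def L2_def mem_Collect_eq
proof (intro conjI ballI allI impI)
  show "AE x in lborel. x \<notin> \<Omega> \<longrightarrow> rep_l2 (0 :: 'a l2) x = 0"
    using rep_l2_0[where 'a = 'a] by eventually_elim simp
next
  fix u v :: "'a l2" and c
  assume u: "u \<in> {u. AE x in lborel. x \<notin> \<Omega> \<longrightarrow> rep_l2 u x = 0}"
  then have u: "AE x in lborel. x \<notin> \<Omega> \<longrightarrow> rep_l2 u x = 0" by simp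
  show "AE x in lborel. x \<notin> \<Omega> \<longrightarrow> rep_l2 (c *\<^sub>R u) x = 0"
    using u rep_l2_scaleR[of c u] by eventually_elim simp
  assume "v \<in> {u. AE x in lborel. x \<notin> \<Omega> \<longrightarrow> rep_l2 u x = 0}"
  then have v: "AE x in lborel. x \<notin> \<Omega> \<longrightarrow> rep_l2 v x = 0" by simp
  show "AE x in lborel. x \<notin> \<Omega> \<longrightarrow> rep_l2 (u + v) x = 0"
    using u v rep_l2_add[of u v] by eventually_elim simp
qed

section \<open>The fundamental lemma of the calculus of variations\<close>

text \<open>The boxes are an intersection-stable generator of the Borel sets.\<close>

lemma set_integral_box_zero_imp_AE_zero:
  fixes f :: "space \<Rightarrow> real"
  assumes f: "integrable lborel f" and total: "integral\<^sup>L lborel f = 0"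
    and zero: "\<And>a b. (LINT x:box a b|lborel. f x) = 0"
  shows "AE x in lborel. f x = 0"
proof (rule sigma_finite_measure.density_zero[OF sigma_finite_lborel f])
  have si: "set_integrable lborel A f" if "A \<in> sets borel" for A
    using integrable_mult_indicator[OF _ f] that by (simp add: set_integrable_def)
  have "Int_stable (range (\<lambda>(a, b). box a b :: space set))"
    by (auto simp: Int_stable_def box_Int_box)
  moreover have "range (\<lambda>(a, b). box a b :: space set) \<subseteq> Pow UNIV" by simp
  moreover fix A :: "space set" assume "A \<in> sets lborel"
  then have "A \<in> sigma_sets UNIV (range (\<lambda>(a, b). box a b))"
    by (simp add: borel_eq_box)
  ultimately show "(LINT x:A|lborel. f x) = 0"
  proof (induction A rule: sigma_sets_induct_disjoint)
    case (basic A)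
    then show ?case using zero by auto
  next
    case empty
    show ?case by (simp add: set_lebesgue_integral_def)
  next
    case (compl A)
    then have A: "A \<in> sets borel" by (simp add: borel_eq_box)
    have "(LINT x:UNIV|lborel. f x) = (LINT x:A|lborel. f x) + (LINT x:UNIV - A|lborel. f x)"
      using set_integral_Un[of A "UNIV - A" lborel f] si[OF A] si[of "UNIV - A"] A by simp
    then show ?case using compl.IH total by (simp add: set_lebesgue_integral_def)
  next
    case (union A)
    then have A: "A i \<in> sets borel" for i by (auto simp: borel_eq_box)
    have "(LINT x:(\<Union>i. A i)|lborel. f x) = (\<Sum>i. LINT x:A i|lborel. f x)"
      using union.hyps(1) A si by (intro lebesgue_integral_countable_add) (auto simp: disjoint_family_on_def)
    then show ?case using union.IH by simp
  qed
qed

lemma square_integrable_indicator: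
  fixes g :: "space \<Rightarrow> 'b::euclidean_space"
  assumes A: "A \<in> sets borel" "bounded A" and g: "continuous_on UNIV g"
  shows "square_integrable (\<lambda>x. indicator A x *\<^sub>R g x)"
proof -
  have m: "(\<lambda>x. indicator A x *\<^sub>R g x) \<in> borel_measurable lborel"
    using A(1) borel_measurable_continuous_onI[OF g] by measurable
  have "integrable lborel (\<lambda>x. (norm (indicator A x *\<^sub>R g x))\<^sup>2)"
  proof (rule Bochner_Integration.integrable_bound)
    show "integrable lborel (\<lambda>x. indicator (closure A) x *\<^sub>R (norm (g x))\<^sup>2)"
      using A(2) by (intro borel_integrable_compact continuous_intros continuous_on_subset[OF g]) auto
    show "AE x in lborel. norm ((norm (indicator A x *\<^sub>R g x))\<^sup>2)
        \<le> norm (indicator (closure A) x *\<^sub>R (norm (g x))\<^sup>2)"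
      using closure_subset[of A] by (auto simp: indicator_def)
  qed (use m in measurable)
  with m show ?thesis by (simp add: square_integrable_def)
qed

lemma square_integrable_vec_iff:
  fixes f :: "space \<Rightarrow> real^3"
  shows "square_integrable f \<longleftrightarrow> (\<forall>i. square_integrable (\<lambda>x. f x $ i))"
proof
  assume f: "square_integrable f"
  show "\<forall>i. square_integrable (\<lambda>x. f x $ i)"
  proof
    fix i
    have m: "(\<lambda>x. f x $ i) \<in> borel_measurable lborel"
      using f borel_measurable_continuous_onI[OF continuous_on_component[OF continuous_on_id]]
      by (auto simp: square_integrable_def intro: measurable_compose)
    have "integrable lborel (\<lambda>x. (norm (f x $ i))\<^sup>2)"
    proof (rule Bochner_Integration.integrable_bound)
      show "integrable lborel (\<lambda>x. (norm (f x))\<^sup>2)" using f by (simp add: square_integrable_def)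
      show "AE x in lborel. norm ((norm (f x $ i))\<^sup>2) \<le> norm ((norm (f x))\<^sup>2)"
        using component_le_norm_cart[of _ i] by (auto simp: abs_le_square_iff[symmetric] intro!: always_eventually)
    qed (use m in measurable)
    with m show "square_integrable (\<lambda>x. f x $ i)" by (simp add: square_integrable_def)
  qed
next
  assume f: "\<forall>i. square_integrable (\<lambda>x. f x $ i)"
  have m: "f \<in> borel_measurable lborel"
    using f by (auto simp: square_integrable_def borel_measurable_euclidean_space[of f] Basis_vec_def inner_axis)
  have "(norm (f x))\<^sup>2 = (\<Sum>i\<in>UNIV. (norm (f x $ i))\<^sup>2)" for x
    by (simp add: norm_vec_def L2_set_def sum_nonneg)
  then have "integrable lborel (\<lambda>x. (norm (f x))\<^sup>2)"
    using f by (simp add: square_integrable_def)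
  with m show "square_integrable f" by (simp add: square_integrable_def)
qed

lemma smooth_differentiable: "smooth f \<Longrightarrow> f differentiable (at x)"
  by (erule smooth.cases) auto

lemma smooth_frechet_derivative: "smooth f \<Longrightarrow> smooth (\<lambda>x. frechet_derivative f (at x) v)"
  by (erule smooth.cases) auto

lemma smooth_continuous: "smooth f \<Longrightarrow> continuous_on UNIV f"
  by (simp add: continuous_at_imp_continuous_on differentiable_imp_continuous_within smooth_differentiable)

text \<open>Differentiation does not enlarge the support.\<close>

lemma test_function_partial_deriv:
  assumes "\<phi> \<in> test_functions \<Omega>" shows "partial_deriv i \<phi> \<in> test_functions \<Omega>"
proof -
  let ?S = "closure {x. \<phi> x \<noteq> 0}"
  have \<phi>: "smooth \<phi>" "compact ?S" "?S \<subseteq> \<Omega>" using assms by (auto simp: test_functions_def)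
  have "partial_deriv i \<phi> x = 0" if "x \<notin> ?S" for x
  proof -
    have "((\<lambda>_. 0) has_derivative (\<lambda>_. 0)) (at x)" by simp
    moreover have "open (- ?S)" "x \<in> - ?S" using that by auto
    moreover have "0 = \<phi> y" if "y \<in> - ?S" for y
      using that closure_subset[of "{x. \<phi> x \<noteq> 0}"] by fastforce
    ultimately have "(\<phi> has_derivative (\<lambda>_. 0)) (at x)"
      by (rule has_derivative_transform_within_open)
    from frechet_derivative_at[OF this] show ?thesis by (simp add: partial_deriv_def fun_eq_iff)
  qed
  then show ?thesis
    using smooth_frechet_derivative[OF \<phi>(1)]
    by (intro test_functions_support[OF _ \<phi>(2,3)]) (simp_all add: partial_deriv_def[abs_def])
qed

lemma square_integrable_test_function:
  fixes \<phi> :: "space \<Rightarrow> 'b::euclidean_space"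
  assumes "\<phi> \<in> test_functions \<Omega>" shows "square_integrable \<phi>"
proof -
  let ?S = "closure {x. \<phi> x \<noteq> 0}"
  have \<phi>: "smooth \<phi>" "compact ?S" using assms by (auto simp: test_functions_def)
  have c: "continuous_on UNIV \<phi>" using smooth_continuous[OF \<phi>(1)] .
  have "integrable lborel (\<lambda>x. indicator ?S x *\<^sub>R (norm (\<phi> x))\<^sup>2)"
    by (rule borel_integrable_compact[OF \<phi>(2)])
       (intro continuous_intros continuous_on_subset[OF c], simp)
  moreover have "(\<lambda>x. indicator ?S x *\<^sub>R (norm (\<phi> x))\<^sup>2) = (\<lambda>x. (norm (\<phi> x))\<^sup>2)"
    using closure_subset[of "{x. \<phi> x \<noteq> 0}"] by (fastforce simp: indicator_def)
  ultimately show ?thesis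
    using borel_measurable_continuous_onI[OF c] by (simp add: square_integrable_def)
qed

text \<open>
  On a box whose closure lies in \<open>\<Omega>\<close>, the indicators of all smaller boxes are bounded limits of test
  functions, so all box integrals of each component of \<open>g\<close> vanish. Countably many such boxes cover \<open>\<Omega>\<close>,
  which makes the union of the exceptional null sets null.
\<close>

lemma l2_eq_0_if_orthogonal_to_test_functions:
  fixes g :: "'b::euclidean_space l2"
  assumes \<Omega>: "open \<Omega>" and g: "g \<in> L2 \<Omega>"
    and orth: "\<And>\<phi>. \<phi> \<in> test_functions \<Omega> \<Longrightarrow> g \<bullet> abs_l2 \<phi> = 0"
  shows "g = 0"
proof -
  define h where "h = rep_l2 g"
  have h: "square_integrable h" and gh: "g = abs_l2 h"
    by (simp_all add: h_def square_integrable_rep abs_rep_l2)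
  \<comment> \<open>only the open box: this is what the cut-offs converge to\<close>
  have zero_on_box: "AE x in lborel. x \<in> box a b \<longrightarrow> h x \<bullet> e = 0" if ab: "cbox a b \<subseteq> \<Omega>" for a b e
  proof -
    let ?f = "\<lambda>x. indicator (box a b) x * (h x \<bullet> e)"
    have int: "integrable lborel ?f"
    proof -
      have "square_integrable (\<lambda>x. indicator (box a b) x *\<^sub>R e)"
        by (rule square_integrable_indicator) auto
      from square_integrable_inner[OF h this] show ?thesis by (simp add: mult.commute)
    qed
    have sub: "integral\<^sup>L lborel (\<lambda>x. indicator (box c d) x * (h x \<bullet> e)) = 0"
      if cd: "box c d \<subseteq> box a b" for c d
    proof (cases "box c d = {}")
      case False
      then have "cbox c d \<subseteq> cbox a b"
        using cd by (metis box_subset_cbox closure_box closure_minimal closed_cbox order_trans)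
      then have "cbox c d \<subseteq> \<Omega>" using ab by blast
      then have test: "(\<lambda>x. box_cutoff n c d x *\<^sub>R e) \<in> test_functions \<Omega>" for n
        by (rule box_cutoff_test_function)
      have "(LINT x|lborel. box_cutoff n c d x * (h x \<bullet> e)) = 0" for n
        using orth[OF test] by (simp add: gh abs_l2_inner h square_integrable_test_function[OF test])
      moreover have "(\<lambda>n. LINT x|lborel. box_cutoff n c d x * (h x \<bullet> e)) \<longlonglongrightarrow>
          (LINT x|lborel. indicator (box c d) x * (h x \<bullet> e))"
      proof (rule integral_dominated_convergence)
        show "integrable lborel (\<lambda>x. norm (?f x))" using int by (rule integrable_norm)
        show "AE x in lborel. (\<lambda>n. box_cutoff n c d x * (h x \<bullet> e)) \<longlonglongrightarrow> indicator (box c d) x * (h x \<bullet> e)"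
          by (intro always_eventually allI tendsto_mult tendsto_const box_cutoff_tendsto)
        have hm: "h \<in> borel_measurable lborel" using h by (simp add: square_integrable_def)
        show "(\<lambda>x. indicator (box c d) x * (h x \<bullet> e)) \<in> borel_measurable lborel"
          using hm by measurable
        fix n
        have "(\<lambda>x. box_cutoff n c d x *\<^sub>R e) \<in> borel_measurable lborel"
          using square_integrable_test_function[OF test] by (simp add: square_integrable_def)
        from borel_measurable_inner[OF hm this]
        show "(\<lambda>x. box_cutoff n c d x * (h x \<bullet> e)) \<in> borel_measurable lborel" by simp
        have "\<bar>box_cutoff n c d x\<bar> \<le> indicator (box a b) x" for x
          using box_cutoff_outside[of x c d n] box_cutoff_bounds[of n c d x] cd
          by (auto simp: indicator_def)
        then show "AE x in lborel. norm (box_cutoff n c d x * (h x \<bullet> e)) \<le> norm (?f x)"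
          by (auto simp: abs_mult intro!: always_eventually mult_right_mono)
      qed
      ultimately show ?thesis by (simp add: LIMSEQ_const_iff)
    qed simp
    have "AE x in lborel. ?f x = 0"
    proof (rule set_integral_box_zero_imp_AE_zero[OF int])
      show "integral\<^sup>L lborel ?f = 0" by (rule sub) simp
      fix c d
      obtain p q where pq: "box c d \<inter> box a b = box p q"
        using box_Int_box[of c d a b] by blast
      have "(LINT x:box c d|lborel. ?f x) = (LINT x|lborel. indicator (box p q) x * (h x \<bullet> e))"
        unfolding set_lebesgue_integral_def pq[symmetric]
        by (simp add: indicator_inter_arith mult.assoc)
      also have "\<dots> = 0" by (rule sub) (use pq in blast)
      finally show "(LINT x:box c d|lborel. ?f x) = 0" .
    qed
    then show ?thesis by eventually_elim (auto simp: indicator_def)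
  qed
  let ?B = "{box a b | a b. cbox a b \<subseteq> \<Omega>}"
  have "\<Union>?B = \<Omega>"
  proof (intro equalityI subsetI)
    fix x assume "x \<in> \<Omega>"
    from open_contains_cbox[OF \<Omega> this] obtain a b where "cbox a b \<subseteq> \<Omega>" "x \<in> box a b" by metis
    then show "x \<in> \<Union>?B" by blast
  next
    fix x assume "x \<in> \<Union>?B"
    then obtain a b where "cbox a b \<subseteq> \<Omega>" "x \<in> box a b" by blast
    then show "x \<in> \<Omega>" using box_subset_cbox[of a b] by blast
  qed
  moreover obtain B' where B': "B' \<subseteq> ?B" "countable B'" "\<Union>B' = \<Union>?B"
    by (rule Lindelof[of ?B]) auto
  ultimately have cover: "\<Union>B' = \<Omega>" by simp
  have "AE x in lborel. \<forall>b\<in>B'. \<forall>e\<in>Basis. x \<in> b \<longrightarrow> h x \<bullet> e = 0"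
  proof (intro AE_ball_countable[THEN iffD2] ballI)
    fix b e assume "b \<in> B'" "e \<in> (Basis :: 'b set)"
    then show "AE x in lborel. x \<in> b \<longrightarrow> h x \<bullet> e = 0" using B'(1) zero_on_box by blast
  qed (simp_all add: B' countable_finite)
  moreover have "AE x in lborel. x \<notin> \<Omega> \<longrightarrow> h x = 0" using g by (simp add: L2_def h_def)
  ultimately have "AE x in lborel. h x = 0"
    by eventually_elim (metis UnionE cover euclidean_all_zero_iff)
  then show ?thesis
    using rep_l2_0 by (intro l2_eqI) (auto simp: h_def elim: eventually_elim2)
qed

section \<open>Weak derivatives and spaces with vanishing trace\<close>

lemma subspace_closure:
  fixes C :: "'a::real_normed_vector set"
  assumes C: "subspace C" shows "subspace (closure C)"
  unfolding subspace_def
proof (intro conjI ballI allI)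
  show "0 \<in> closure C" using subspace_0[OF C] closure_subset by blast
next
  fix x y c assume "x \<in> closure C"
  then obtain f where f: "\<And>n. f n \<in> C" "f \<longlonglongrightarrow> x" unfolding closure_sequential by blast
  have "\<And>n. c *\<^sub>R f n \<in> C" "(\<lambda>n. c *\<^sub>R f n) \<longlonglongrightarrow> c *\<^sub>R x"
    using f C by (auto simp: subspace_scale intro: tendsto_intros)
  then show "c *\<^sub>R x \<in> closure C" unfolding closure_sequential by (intro exI[of _ "\<lambda>n. c *\<^sub>R f n"]) simp
  assume "y \<in> closure C"
  then obtain g where g: "\<And>n. g n \<in> C" "g \<longlonglongrightarrow> y" unfolding closure_sequential by blast
  have "\<And>n. f n + g n \<in> C" "(\<lambda>n. f n + g n) \<longlonglongrightarrow> x + y"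
    using f g C by (auto simp: subspace_add intro: tendsto_intros)
  then show "x + y \<in> closure C" unfolding closure_sequential by (intro exI[of _ "\<lambda>n. f n + g n"]) simp
qed

text \<open>
  The common pattern of \<open>is_weak_grad\<close>, \<open>is_weak_curl\<close> and \<open>is_weak_div\<close>: a weak derivative of \<open>u\<close> is an
  element of \<open>H\<close> whose pairing with \<open>Q \<phi>\<close> is that of \<open>u\<close> with \<open>P \<phi>\<close>. The assumption that the \<open>Q \<phi>\<close> separate
  the elements of \<open>H\<close> turns the definite description of the derivative into a linear operator.
\<close>

locale weak_derivative =
  fixes L :: "'a::real_inner set" and H :: "'b::real_inner set"
    and T :: "'c set" and P :: "'c \<Rightarrow> 'a" and Q :: "'c \<Rightarrow> 'b"
    and rel :: "'a \<Rightarrow> 'b \<Rightarrow> bool" and d :: "'a \<Rightarrow> 'b"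
  assumes L: "subspace L" and H: "subspace H"
    and rel: "\<And>u g. rel u g \<longleftrightarrow> g \<in> H \<and> (\<forall>\<phi>\<in>T. u \<bullet> P \<phi> = g \<bullet> Q \<phi>)"
    and d: "\<And>u. d u = (THE g. rel u g)"
    and separating: "\<And>g. g \<in> H \<Longrightarrow> (\<And>\<phi>. \<phi> \<in> T \<Longrightarrow> g \<bullet> Q \<phi> = 0) \<Longrightarrow> g = 0"
begin

definition "domain = {u \<in> L. \<exists>g. rel u g}"

lemma d_eq: "rel u g \<Longrightarrow> d u = g"
  unfolding d
proof (rule the_equality)
  fix g' assume "rel u g" "rel u g'"
  then have "g' - g = 0"
    by (intro separating) (auto simp: rel inner_diff_left H subspace_diff)
  then show "g' = g" by simp
qed

lemma rel_d: "u \<in> domain \<Longrightarrow> rel u (d u)"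
  using d_eq by (auto simp: domain_def)

lemma rel_add: "rel u g \<Longrightarrow> rel v h \<Longrightarrow> rel (u + v) (g + h)"
  and rel_scaleR: "rel u g \<Longrightarrow> rel (c *\<^sub>R u) (c *\<^sub>R g)"
  and rel_0: "rel 0 0"
  by (auto simp: rel H subspace_add subspace_scale subspace_0 inner_add_left)

lemma subspace_domain: "subspace domain"
  using L rel_add rel_scaleR rel_0 unfolding subspace_def domain_def by blast

lemma d_add: "u \<in> domain \<Longrightarrow> v \<in> domain \<Longrightarrow> d (u + v) = d u + d v"
  and d_scaleR: "u \<in> domain \<Longrightarrow> d (c *\<^sub>R u) = c *\<^sub>R d u"
  and d_0: "d 0 = 0"
  by (auto intro: d_eq rel_add rel_scaleR rel_0 rel_d)

lemma subspace_closure_domain: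
  assumes C: "subspace C"
  shows "subspace {u \<in> domain. (u, d u) \<in> closure C}"
proof -
  have C: "subspace (closure C)" using C by (rule subspace_closure)
  then show ?thesis
    using subspace_domain subspace_0[OF C] subspace_add[OF C] subspace_scale[OF C]
    by (fastforce simp: subspace_def d_0 d_add d_scaleR zero_prod_def)
qed

end

lemma frechet_derivative_add:
  assumes "smooth \<phi>" "smooth \<psi>"
  shows "frechet_derivative (\<lambda>x. \<phi> x + \<psi> x) (at x) =
     (\<lambda>v. frechet_derivative \<phi> (at x) v + frechet_derivative \<psi> (at x) v)"
  using assms[THEN smooth_differentiable, of x]
  by (intro frechet_derivative_at[symmetric] has_derivative_add) (simp_all flip: frechet_derivative_works)

lemma frechet_derivative_scaleR:
  assumes "smooth \<phi>"
  shows "frechet_derivative (\<lambda>x. c *\<^sub>R \<phi> x) (at x) = (\<lambda>v. c *\<^sub>R frechet_derivative \<phi> (at x) v)"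
  using smooth_differentiable[OF assms, of x]
  by (intro frechet_derivative_at[symmetric] has_derivative_scaleR_right) (simp flip: frechet_derivative_works)

lemma partial_deriv_add:
  "smooth \<phi> \<Longrightarrow> smooth \<psi> \<Longrightarrow> partial_deriv i (\<lambda>x. \<phi> x + \<psi> x) x = partial_deriv i \<phi> x + partial_deriv i \<psi> x"
  by (simp add: partial_deriv_def frechet_derivative_add)

lemma partial_deriv_scaleR:
  "smooth \<phi> \<Longrightarrow> partial_deriv i (\<lambda>x. c *\<^sub>R \<phi> x) x = c *\<^sub>R partial_deriv i \<phi> x"
  by (simp add: partial_deriv_def frechet_derivative_scaleR)

lemma smooth_0: "smooth (\<lambda>x. 0)"
  by (coinduction rule: smooth.coinduct) auto

lemma smooth_add:
  assumes "smooth \<phi>" "smooth \<psi>" shows "smooth (\<lambda>x. \<phi> x + \<psi> x)"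
  using assms
proof (coinduction arbitrary: \<phi> \<psi> rule: smooth.coinduct)
  case smooth
  then show ?case
    using smooth_frechet_derivative[of \<phi>] smooth_frechet_derivative[of \<psi>]
    by (auto simp: frechet_derivative_add smooth_differentiable intro!: exI)
qed

lemma smooth_scaleR:
  assumes "smooth \<phi>" shows "smooth (\<lambda>x. c *\<^sub>R \<phi> x)"
  using assms
proof (coinduction arbitrary: \<phi> rule: smooth.coinduct)
  case smooth
  then show ?case
    using smooth_frechet_derivative[of \<phi>]
    by (auto simp: frechet_derivative_scaleR smooth_differentiable intro!: exI)
qed

lemma test_functions_0: "(\<lambda>x. 0) \<in> test_functions \<Omega>"
  by (simp add: test_functions_def smooth_0)

lemma test_functions_add:
  assumes "\<phi> \<in> test_functions \<Omega>" "\<psi> \<in> test_functions \<Omega>"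
  shows "(\<lambda>x. \<phi> x + \<psi> x) \<in> test_functions \<Omega>"
proof (rule test_functions_support)
  let ?S = "closure {x. \<phi> x \<noteq> 0} \<union> closure {x. \<psi> x \<noteq> 0}"
  show "smooth (\<lambda>x. \<phi> x + \<psi> x)" "compact ?S" "?S \<subseteq> \<Omega>"
    using assms by (auto simp: test_functions_def smooth_add)
  show "\<phi> x + \<psi> x = 0" if "x \<notin> ?S" for x
  proof -
    have "\<phi> x = 0" "\<psi> x = 0"
      using that closure_subset[of "{x. \<phi> x \<noteq> 0}"] closure_subset[of "{x. \<psi> x \<noteq> 0}"] by blast+
    then show ?thesis by simp
  qed
qed

lemma test_functions_scaleR:
  assumes "\<phi> \<in> test_functions \<Omega>"
  shows "(\<lambda>x. c *\<^sub>R \<phi> x) \<in> test_functions \<Omega>"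
proof (rule test_functions_support)
  let ?S = "closure {x. \<phi> x \<noteq> 0}"
  show "smooth (\<lambda>x. c *\<^sub>R \<phi> x)" "compact ?S" "?S \<subseteq> \<Omega>"
    using assms by (auto simp: test_functions_def smooth_scaleR)
  show "c *\<^sub>R \<phi> x = 0" if "x \<notin> ?S" for x
  proof -
    have "\<phi> x = 0" using that closure_subset[of "{x. \<phi> x \<noteq> 0}"] by blast
    then show ?thesis by simp
  qed
qed

text \<open>
  The graphs whose closures define the spaces with vanishing trace. Square integrability of \<open>D \<phi>\<close> is
  what makes \<open>abs_l2\<close> additive on these derivatives.
\<close>

lemma subspace_graph_of_test_functions:
  fixes D :: "(space \<Rightarrow> 'a::euclidean_space) \<Rightarrow> space \<Rightarrow> 'b::euclidean_space"
  assumes add: "\<And>\<phi> \<psi> x. smooth \<phi> \<Longrightarrow> smooth \<psi> \<Longrightarrow> D (\<lambda>x. \<phi> x + \<psi> x) x = D \<phi> x + D \<psi> x"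
    and scale: "\<And>c \<phi> x. smooth \<phi> \<Longrightarrow> D (\<lambda>x. c *\<^sub>R \<phi> x) x = c *\<^sub>R D \<phi> x"
    and sq: "\<And>\<phi>. \<phi> \<in> test_functions \<Omega> \<Longrightarrow> square_integrable (D \<phi>)"
  shows "subspace ((\<lambda>\<phi>. (abs_l2 \<phi>, abs_l2 (D \<phi>))) ` test_functions \<Omega>)" (is "subspace (?f ` ?T)")
proof -
  have smooth: "smooth \<phi>" if "\<phi> \<in> ?T" for \<phi> using that by (simp add: test_functions_def)
  have a: "?f \<phi> + ?f \<psi> = ?f (\<lambda>x. \<phi> x + \<psi> x)" if "\<phi> \<in> ?T" "\<psi> \<in> ?T" for \<phi> \<psi>
  proof -
    have "D (\<lambda>x. \<phi> x + \<psi> x) = (\<lambda>x. D \<phi> x + D \<psi> x)" using that by (auto intro: add smooth)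
    then show ?thesis using that by (simp add: sq abs_l2_add square_integrable_test_function)
  qed
  have s: "c *\<^sub>R ?f \<phi> = ?f (\<lambda>x. c *\<^sub>R \<phi> x)" if "\<phi> \<in> ?T" for c \<phi>
  proof -
    have "D (\<lambda>x. c *\<^sub>R \<phi> x) = (\<lambda>x. c *\<^sub>R D \<phi> x)" using that by (auto intro: scale smooth)
    then show ?thesis using that by (simp add: sq abs_l2_scaleR square_integrable_test_function)
  qed
  have "0 \<in> ?f ` ?T"
    using s[OF test_functions_0, of 0] test_functions_0[of \<Omega>] 
    by (intro image_eqI[of _ _ "\<lambda>x. 0"]) (simp_all add: zero_prod_def)
  moreover have "p + q \<in> ?f ` ?T" if "p \<in> ?f ` ?T" "q \<in> ?f ` ?T" for p q
  proof -
    from that obtain \<phi> \<psi> where "p = ?f \<phi>" "q = ?f \<psi>" "\<phi> \<in> ?T" "\<psi> \<in> ?T" by blast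
    then show ?thesis using a[of \<phi> \<psi>] test_functions_add[of \<phi> \<Omega> \<psi>] by (simp only: image_eqI)
  qed
  moreover have "c *\<^sub>R p \<in> ?f ` ?T" if "p \<in> ?f ` ?T" for c p
  proof -
    from that obtain \<phi> where "p = ?f \<phi>" "\<phi> \<in> ?T" by blast
    then show ?thesis using s[of \<phi> c] test_functions_scaleR[of \<phi> \<Omega> c] by (simp only: image_eqI)
  qed
  ultimately show ?thesis by (auto simp: subspace_def)
qed

lemma square_integrable_partial_deriv:
  "\<phi> \<in> test_functions \<Omega> \<Longrightarrow> square_integrable (partial_deriv i \<phi>)"
  by (intro square_integrable_test_function test_function_partial_deriv)

lemma square_integrable_partial_deriv_component:
  fixes \<phi> :: "space \<Rightarrow> real^3"
  shows "\<phi> \<in> test_functions \<Omega> \<Longrightarrow> square_integrable (\<lambda>x. partial_deriv i \<phi> x $ j)"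
  using square_integrable_partial_deriv square_integrable_vec_iff by blast

lemma square_integrable_grad: "\<phi> \<in> test_functions \<Omega> \<Longrightarrow> square_integrable (grad \<phi>)"
  by (simp add: square_integrable_vec_iff[of "grad \<phi>"] grad_def square_integrable_partial_deriv[unfolded eta_contract_eq])

lemma square_integrable_curl: "\<phi> \<in> test_functions \<Omega> \<Longrightarrow> square_integrable (curl \<phi>)"
  by (simp add: square_integrable_vec_iff[of "curl \<phi>"] curl_def forall_3 square_integrable_diff
      square_integrable_partial_deriv_component)

lemma square_integrable_divergence: "\<phi> \<in> test_functions \<Omega> \<Longrightarrow> square_integrable (divergence \<phi>)"
  by (simp add: divergence_def[abs_def] sum_3 square_integrable_add
      square_integrable_partial_deriv_component)

lemma subspace_graph_grad:
  "subspace ((\<lambda>\<phi>. (abs_l2 \<phi>, abs_l2 (grad \<phi>))) ` test_functions \<Omega>)"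
  by (rule subspace_graph_of_test_functions)
     (auto simp: grad_def vec_eq_iff partial_deriv_add partial_deriv_scaleR[where \<phi> = "_ :: space \<Rightarrow> real", simplified]
        square_integrable_grad)

lemma subspace_graph_curl:
  "subspace ((\<lambda>\<phi>. (abs_l2 \<phi>, abs_l2 (curl \<phi>))) ` test_functions \<Omega>)"
  by (rule subspace_graph_of_test_functions)
     (auto simp: curl_def vec_eq_iff forall_3 partial_deriv_add partial_deriv_scaleR
        square_integrable_curl algebra_simps)

lemma subspace_graph_divergence:
  "subspace ((\<lambda>\<phi>. (abs_l2 \<phi>, abs_l2 (divergence \<phi>))) ` test_functions \<Omega>)"
  by (rule subspace_graph_of_test_functions)
     (auto simp: divergence_def sum_3 partial_deriv_add partial_deriv_scaleR
        square_integrable_divergence algebra_simps)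

locale open_domain =
  fixes \<Omega> :: "space set"
  assumes open_domain: "open \<Omega>"
begin

sublocale grad: weak_derivative "L2 \<Omega>" "L2 \<Omega>" "test_functions \<Omega>"
  "\<lambda>\<phi>. abs_l2 (divergence \<phi>)" "\<lambda>\<phi>. - abs_l2 \<phi>" "is_weak_grad \<Omega>" "wgrad \<Omega>"
  by unfold_locales (auto intro: l2_eq_0_if_orthogonal_to_test_functions[OF open_domain]
    simp add: subspace_L2 is_weak_grad_def wgrad_def)

sublocale curl: weak_derivative "L2 \<Omega>" "L2 \<Omega>" "test_functions \<Omega>"
  "\<lambda>\<phi>. abs_l2 (curl \<phi>)" "abs_l2" "is_weak_curl \<Omega>" "wcurl \<Omega>"
  by unfold_locales (auto intro: l2_eq_0_if_orthogonal_to_test_functions[OF open_domain]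
    simp add: subspace_L2 is_weak_curl_def wcurl_def)

sublocale div: weak_derivative "L2 \<Omega>" "L2 \<Omega>" "test_functions \<Omega>"
  "\<lambda>\<phi>. abs_l2 (grad \<phi>)" "\<lambda>\<phi>. - abs_l2 \<phi>" "is_weak_div \<Omega>" "wdiv \<Omega>"
  by unfold_locales (auto intro: l2_eq_0_if_orthogonal_to_test_functions[OF open_domain]
    simp add: subspace_L2 is_weak_div_def wdiv_def)

lemma domain_eq: "grad.domain = H1 \<Omega>" "curl.domain = Hcurl \<Omega>" "div.domain = Hdiv \<Omega>"
  by (simp_all add: grad.domain_def curl.domain_def div.domain_def H1_def Hcurl_def Hdiv_def)

lemma subspace_H1_0: "subspace (H1_0 \<Omega>)"
  and subspace_Hcurl_0: "subspace (Hcurl_0 \<Omega>)"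
  and subspace_Hdiv_0: "subspace (Hdiv_0 \<Omega>)"
  using grad.subspace_closure_domain[OF subspace_graph_grad]
    curl.subspace_closure_domain[OF subspace_graph_curl]
    div.subspace_closure_domain[OF subspace_graph_divergence]
  by (simp_all add: H1_0_def Hcurl_0_def Hdiv_0_def domain_eq)

end

section \<open>Finite dimensionality of the finite element spaces\<close>

definition function_subspace :: "('a \<Rightarrow> 'b::real_vector) set \<Rightarrow> bool" where
  "function_subspace P \<longleftrightarrow> (\<lambda>x. 0) \<in> P \<and> (\<forall>p\<in>P. \<forall>q\<in>P. (\<lambda>x. p x + q x) \<in> P) \<and>
     (\<forall>c. \<forall>p\<in>P. (\<lambda>x. c *\<^sub>R p x) \<in> P)"

text \<open>
  Containment in a finite dimensional space, which need not be equality. The spanning functions are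
  continuous because their restrictions to the cells have to be square integrable.
\<close>

definition finitely_spanned :: "(space \<Rightarrow> 'b::real_normed_vector) set \<Rightarrow> bool" where
  "finitely_spanned P \<longleftrightarrow> (\<exists>G. finite G \<and> (\<forall>g\<in>G. continuous_on UNIV g) \<and>
     (\<forall>p\<in>P. \<exists>c. p = (\<lambda>x. \<Sum>g\<in>G. c g *\<^sub>R g x)))"

text \<open>
  An indexed family may repeat functions; the coefficients of equal members are added up.
\<close>

lemma finitely_spannedI:
  assumes I: "finite I" and m: "\<And>i. i \<in> I \<Longrightarrow> continuous_on UNIV (m i)"
    and P: "\<And>p. p \<in> P \<Longrightarrow> \<exists>c. p = (\<lambda>x. \<Sum>i\<in>I. c i *\<^sub>R m i x)"
  shows "finitely_spanned P"
  unfolding finitely_spanned_def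
proof (intro exI[of _ "m ` I"] conjI ballI)
  fix p assume "p \<in> P"
  then obtain c where c: "p = (\<lambda>x. \<Sum>i\<in>I. c i *\<^sub>R m i x)" using P by blast
  have "p = (\<lambda>x. \<Sum>g\<in>m ` I. (\<Sum>i\<in>{i \<in> I. m i = g}. c i) *\<^sub>R g x)"
    unfolding c by (auto simp: sum.image_gen[OF I, of _ m] scaleR_left.sum intro!: sum.cong)
  then show "\<exists>c. p = (\<lambda>x. \<Sum>g\<in>m ` I. c g *\<^sub>R g x)" by (rule exI[of _ "\<lambda>g. \<Sum>i\<in>{i \<in> I. m i = g}. c i"])
qed (use I m in auto)

lemma finitely_spanned_subset: "finitely_spanned Q \<Longrightarrow> P \<subseteq> Q \<Longrightarrow> finitely_spanned P"
  unfolding finitely_spanned_def by blast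

text \<open>
  The shape of the first kind elements: \<open>L x\<close> is \<open>cross3 x\<close> for edge elements and \<open>t \<mapsto> t *\<^sub>R x\<close> for face
  elements. With a constant \<open>L x\<close> it also assembles vector polynomials from their components.
\<close>

lemma finitely_spanned_plus_image:
  assumes P: "finitely_spanned P" and Q: "finitely_spanned Q" and L: "\<And>x. linear (L x)"
    and cont: "\<And>g. continuous_on UNIV g \<Longrightarrow> continuous_on UNIV (\<lambda>x. L x (g x))"
  shows "finitely_spanned {\<lambda>x. p x + L x (q x) | p q. p \<in> P \<and> q \<in> Q}"
proof -
  obtain G where G: "finite G" "\<And>g. g \<in> G \<Longrightarrow> continuous_on UNIV g"
    "\<And>p. p \<in> P \<Longrightarrow> \<exists>c. p = (\<lambda>x. \<Sum>g\<in>G. c g *\<^sub>R g x)"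
    using P unfolding finitely_spanned_def by blast
  obtain H where H: "finite H" "\<And>g. g \<in> H \<Longrightarrow> continuous_on UNIV g"
    "\<And>p. p \<in> Q \<Longrightarrow> \<exists>c. p = (\<lambda>x. \<Sum>g\<in>H. c g *\<^sub>R g x)"
    using Q unfolding finitely_spanned_def by blast
  let ?m = "case_sum (\<lambda>g. g) (\<lambda>g x. L x (g x))"
  show ?thesis
  proof (rule finitely_spannedI[of "G <+> H" ?m])
    fix f assume "f \<in> {\<lambda>x. p x + L x (q x) | p q. p \<in> P \<and> q \<in> Q}"
    then obtain p q where f: "f = (\<lambda>x. p x + L x (q x))" "p \<in> P" "q \<in> Q" by blast
    obtain c d where "p = (\<lambda>x. \<Sum>g\<in>G. c g *\<^sub>R g x)" "q = (\<lambda>x. \<Sum>g\<in>H. d g *\<^sub>R g x)"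
      using G(3)[OF f(2)] H(3)[OF f(3)] by blast
    then have "f = (\<lambda>x. \<Sum>i\<in>G <+> H. case_sum c d i *\<^sub>R ?m i x)"
      by (simp add: f(1) sum.Plus G H linear_sum[OF L] linear_scale[OF L])
    then show "\<exists>c. f = (\<lambda>x. \<Sum>i\<in>G <+> H. c i *\<^sub>R ?m i x)" by blast
  qed (use G H cont in auto)
qed

lemma function_subspace_plus_image:
  assumes P: "function_subspace P" and Q: "function_subspace Q" and L: "\<And>x. linear (L x)"
  shows "function_subspace {\<lambda>x. p x + L x (q x) | p q. p \<in> P \<and> q \<in> Q}" (is "function_subspace ?S")
proof -
  have I: "f \<in> ?S" if "f = (\<lambda>x. p x + L x (q x))" "p \<in> P" "q \<in> Q" for f p q
    using that by blast
  show ?thesis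
    unfolding function_subspace_def
  proof (intro conjI ballI allI)
    show "(\<lambda>x. 0) \<in> ?S"
      by (rule I[of _ "\<lambda>x. 0" "\<lambda>x. 0"])
         (use P Q in \<open>auto simp: function_subspace_def linear_0[OF L]\<close>)
  next
    fix f c assume "f \<in> ?S"
    then obtain p q where f: "f = (\<lambda>x. p x + L x (q x))" "p \<in> P" "q \<in> Q" by blast
    show "(\<lambda>x. c *\<^sub>R f x) \<in> ?S"
      by (rule I[of _ "\<lambda>x. c *\<^sub>R p x" "\<lambda>x. c *\<^sub>R q x"])
         (use P Q f in \<open>auto simp: function_subspace_def linear_scale[OF L] scaleR_add_right\<close>)
    fix g assume "g \<in> ?S"
    then obtain p' q' where g: "g = (\<lambda>x. p' x + L x (q' x))" "p' \<in> P" "q' \<in> Q" by blast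
    show "(\<lambda>x. f x + g x) \<in> ?S"
      by (rule I[of _ "\<lambda>x. p x + p' x" "\<lambda>x. q x + q' x"])
         (use P Q f g in \<open>auto simp: function_subspace_def linear_add[OF L]\<close>)
  qed
qed

lemma finitely_spanned_scalar_poly: "finitely_spanned (scalar_poly r)"
proof (rule finitely_spannedI[of "{(i, j, k). i + j + k \<le> r}"
      "\<lambda>(i, j, k) x. x$1 ^ i * x$2 ^ j * x$3 ^ k"])
  show "finite {(i, j, k). i + j + k \<le> r}"
    by (rule finite_subset[of _ "{..r} \<times> {..r} \<times> {..r}"]) auto
  fix p assume "p \<in> scalar_poly r"
  then obtain c where "\<And>x. p x = (\<Sum>(i, j, k)\<in>{(i, j, k). i + j + k \<le> r}. c i j k * x$1 ^ i * x$2 ^ j * x$3 ^ k)"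
    unfolding scalar_poly_def by blast
  then have "p = (\<lambda>x. \<Sum>t\<in>{(i, j, k). i + j + k \<le> r}. (case t of (i, j, k) \<Rightarrow> c i j k) *\<^sub>R
      (case t of (i, j, k) \<Rightarrow> \<lambda>x. x$1 ^ i * x$2 ^ j * x$3 ^ k) x)"
    by (auto simp: mult.assoc intro!: sum.cong)
  then show "\<exists>c. p = (\<lambda>x. \<Sum>t\<in>{(i, j, k). i + j + k \<le> r}. c t *\<^sub>R
      (case t of (i, j, k) \<Rightarrow> \<lambda>x. x$1 ^ i * x$2 ^ j * x$3 ^ k) x)" by blast
qed (auto intro!: continuous_intros)

lemma finitely_spanned_vector_poly: "finitely_spanned (vector_poly r)"
proof -
  have step: "finitely_spanned {\<lambda>x. p x + q x *\<^sub>R axis i 1 | p q. p \<in> P \<and> q \<in> scalar_poly r}"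
    if "finitely_spanned P" for P :: "(space \<Rightarrow> real^3) set" and i
    by (rule finitely_spanned_plus_image[OF that finitely_spanned_scalar_poly, of "\<lambda>_ t. t *\<^sub>R axis i 1"])
       (auto intro!: continuous_intros linearI simp: scaleR_add_left)
  let ?S = "\<lambda>P (i::3). {\<lambda>x. p x + q x *\<^sub>R axis i (1::real) | p q. p \<in> P \<and> q \<in> scalar_poly r}"
  have "finitely_spanned {\<lambda>x::space. 0 :: real^3}"
    by (rule finitely_spannedI[of "{}" "\<lambda>_ _. 0"]) auto
  then have "finitely_spanned (?S (?S (?S {\<lambda>x. 0} 1) 2) 3)" by (intro step)
  moreover have "vector_poly r \<subseteq> ?S (?S (?S {\<lambda>x. 0} 1) 2) 3"
  proof
    fix p assume "p \<in> vector_poly r"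
    then have p: "(\<lambda>x. p x $ i) \<in> scalar_poly r" for i by (simp add: vector_poly_def)
    have S: "(\<lambda>x. q x + p x $ i *\<^sub>R axis i 1) \<in> ?S P i" if "q \<in> P" for q P i
      unfolding mem_Collect_eq using that p[of i] by (intro exI[of _ q] exI[of _ "\<lambda>x. p x $ i"]) simp
    have "p = (\<lambda>x. 0 + p x $ 1 *\<^sub>R axis 1 1 + p x $ 2 *\<^sub>R axis 2 1 + p x $ 3 *\<^sub>R axis 3 1)"
      by (simp add: fun_eq_iff vec_eq_iff forall_3 axis_def)
    also have "\<dots> \<in> ?S (?S (?S {\<lambda>x. 0} 1) 2) 3" by (intro S) simp
    finally show "p \<in> ?S (?S (?S {\<lambda>x. 0} 1) 2) 3" .
  qed
  ultimately show ?thesis by (rule finitely_spanned_subset)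
qed

lemma linear_cross3: "linear (cross3 x)"
  by (auto intro!: linearI simp: cross_add_right cross_mult_right)

lemma finitely_spanned_edge_shapes: "finitely_spanned (edge_shapes kd k)"
proof (cases kd)
  case First_Kind
  then show ?thesis
    by (simp add: finitely_spanned_plus_image[OF finitely_spanned_vector_poly
        finitely_spanned_vector_poly linear_cross3] continuous_on_cross)
qed (simp add: finitely_spanned_vector_poly)

lemma finitely_spanned_face_shapes: "finitely_spanned (face_shapes kd k)"
proof (cases kd)
  case First_Kind
  then show ?thesis
    using finitely_spanned_plus_image[OF finitely_spanned_vector_poly[of "k - 1"]
      finitely_spanned_scalar_poly[of "k - 1"], of "\<lambda>x t. t *\<^sub>R x"]
    by (simp add: linearI scaleR_add_left continuous_on_scaleR)
qed (simp add: finitely_spanned_vector_poly)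

lemma function_subspace_scalar_poly: "function_subspace (scalar_poly r)"
  unfolding function_subspace_def
proof (intro conjI ballI allI)
  show "(\<lambda>x. 0) \<in> scalar_poly r"
    unfolding scalar_poly_def by (auto intro!: exI[of _ "\<lambda>i j k. 0"])
next
  fix p a assume "p \<in> scalar_poly r"
  then obtain c where c: "\<forall>x. p x = (\<Sum>(i, j, k)\<in>{(i, j, k). i + j + k \<le> r}. c i j k * x$1 ^ i * x$2 ^ j * x$3 ^ k)"
    unfolding scalar_poly_def by blast
  show "(\<lambda>x. a *\<^sub>R p x) \<in> scalar_poly r"
    unfolding scalar_poly_def mem_Collect_eq c[rule_format]
    by (rule exI[of _ "\<lambda>i j k. a * c i j k"]) (simp add: sum_distrib_left case_prod_unfold mult.assoc)
  fix q assume "q \<in> scalar_poly r"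
  then obtain d where d: "\<forall>x. q x = (\<Sum>(i, j, k)\<in>{(i, j, k). i + j + k \<le> r}. d i j k * x$1 ^ i * x$2 ^ j * x$3 ^ k)"
    unfolding scalar_poly_def by blast
  show "(\<lambda>x. p x + q x) \<in> scalar_poly r"
    unfolding scalar_poly_def mem_Collect_eq c[rule_format] d[rule_format]
    by (rule exI[of _ "\<lambda>i j k. c i j k + d i j k"])
       (simp add: sum.distrib[symmetric] case_prod_unfold distrib_right)
qed

lemma function_subspace_vector_poly: "function_subspace (vector_poly r)"
  using function_subspace_scalar_poly[of r] by (simp add: function_subspace_def vector_poly_def)

lemma function_subspace_edge_shapes: "function_subspace (edge_shapes kd k)"
  using function_subspace_plus_image[OF function_subspace_vector_poly function_subspace_vector_poly
      linear_cross3]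
  by (cases kd) (simp_all add: function_subspace_vector_poly)

lemma function_subspace_face_shapes: "function_subspace (face_shapes kd k)"
  using function_subspace_plus_image[OF function_subspace_vector_poly function_subspace_scalar_poly,
      of "\<lambda>x t. t *\<^sub>R x"]
  by (cases kd) (simp_all add: function_subspace_vector_poly linearI scaleR_add_left)

lemma subspace_piecewise:
  assumes P: "function_subspace P" shows "subspace (piecewise \<T> P)"
  unfolding subspace_def
proof (intro conjI ballI allI)
  show "0 \<in> piecewise \<T> P"
    unfolding piecewise_def mem_Collect_eq
  proof
    fix K
    have "AE x in lborel. x \<in> K \<longrightarrow> rep_l2 (0::'a l2) x = 0"
      using rep_l2_0[where 'a = 'a] by eventually_elim simp
    then show "\<exists>p\<in>P. AE x in lborel. x \<in> K \<longrightarrow> rep_l2 0 x = p x"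
      using P unfolding function_subspace_def by (intro bexI[of _ "\<lambda>x. 0"]) auto
  qed
next
  fix u c assume u: "u \<in> piecewise \<T> P"
  show "c *\<^sub>R u \<in> piecewise \<T> P"
    unfolding piecewise_def mem_Collect_eq
  proof
    fix K assume "K \<in> \<T>"
    with u obtain p where p: "p \<in> P" "AE x in lborel. x \<in> K \<longrightarrow> rep_l2 u x = p x"
      unfolding piecewise_def by blast
    have "AE x in lborel. x \<in> K \<longrightarrow> rep_l2 (c *\<^sub>R u) x = c *\<^sub>R p x"
      using p(2) rep_l2_scaleR[of c u] by eventually_elim simp
    then show "\<exists>p\<in>P. AE x in lborel. x \<in> K \<longrightarrow> rep_l2 (c *\<^sub>R u) x = p x"
      using P p(1) unfolding function_subspace_def by (intro bexI[of _ "\<lambda>x. c *\<^sub>R p x"]) auto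
  qed
  fix v assume v: "v \<in> piecewise \<T> P"
  show "u + v \<in> piecewise \<T> P"
    unfolding piecewise_def mem_Collect_eq
  proof
    fix K assume K: "K \<in> \<T>"
    with u obtain p where p: "p \<in> P" "AE x in lborel. x \<in> K \<longrightarrow> rep_l2 u x = p x"
      unfolding piecewise_def by blast
    from K v obtain q where q: "q \<in> P" "AE x in lborel. x \<in> K \<longrightarrow> rep_l2 v x = q x"
      unfolding piecewise_def by blast
    have "AE x in lborel. x \<in> K \<longrightarrow> rep_l2 (u + v) x = p x + q x"
      using p(2) q(2) rep_l2_add[of u v] by eventually_elim simp
    then show "\<exists>p\<in>P. AE x in lborel. x \<in> K \<longrightarrow> rep_l2 (u + v) x = p x"
      using P p(1) q(1) unfolding function_subspace_def by (intro bexI[of _ "\<lambda>x. p x + q x"]) auto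
  qed
qed

lemma abs_l2_sum:
  assumes "finite I" "\<And>i. i \<in> I \<Longrightarrow> square_integrable (f i)"
  shows "square_integrable (\<lambda>x. \<Sum>i\<in>I. f i x) \<and> abs_l2 (\<lambda>x. \<Sum>i\<in>I. f i x) = (\<Sum>i\<in>I. abs_l2 (f i))"
  using assms
  by induction (simp_all add: square_integrable_zero square_integrable_add abs_l2_add flip: zero_l2_def)

text \<open>
  The cells may overlap in their boundaries, so the domain is decomposed into the atoms generated by
  the cells: the points that lie in exactly the cells of a given nonempty subset of \<open>\<T>\<close>. On an atom, the
  polynomial of any of these cells represents the function, and the indicators of the atoms times the
  functions spanning \<open>P\<close> are a finite spanning set.
\<close>

lemma finite_dimensional_piecewise:
  fixes P :: "(space \<Rightarrow> 'b::euclidean_space) set"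
  assumes \<T>: "finite \<T>" "\<And>K. K \<in> \<T> \<Longrightarrow> compact K" and cover: "\<Omega> \<subseteq> \<Union>\<T>"
    and P: "finitely_spanned P"
  shows "\<exists>F. finite F \<and> L2 \<Omega> \<inter> piecewise \<T> P \<subseteq> span F"
proof -
  obtain G where G: "finite G" "\<And>g. g \<in> G \<Longrightarrow> continuous_on UNIV g"
    "\<And>p. p \<in> P \<Longrightarrow> \<exists>c. p = (\<lambda>x. \<Sum>g\<in>G. c g *\<^sub>R g x)"
    using P unfolding finitely_spanned_def by blast
  let ?I = "Pow \<T> - {{}}"
  define atom where "atom \<A> = \<Inter>\<A> - \<Union>(\<T> - \<A>)" for \<A>
  define b where "b \<A> g = (\<lambda>x. indicator (atom \<A>) x *\<^sub>R g x)" for \<A> and g :: "space \<Rightarrow> 'b"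
  have fin: "finite ?I" using \<T>(1) by simp
  have sq: "square_integrable (b \<A> g)" if \<A>: "\<A> \<in> ?I" and g: "g \<in> G" for \<A> g
    unfolding b_def
  proof (rule square_integrable_indicator)
    obtain K where K: "K \<in> \<A>" "K \<in> \<T>" using \<A> by blast
    have "atom \<A> \<subseteq> K" using K(1) by (auto simp: atom_def)
    then show "bounded (atom \<A>)"
      using compact_imp_bounded[OF \<T>(2)[OF K(2)]] bounded_subset by blast
    have "closed K" if "K \<in> \<T>" for K using \<T>(2)[OF that] by (rule compact_imp_closed)
    moreover have "\<A> \<subseteq> \<T>" using \<A> by blast
    ultimately have "closed (\<Inter>\<A>)" "closed (\<Union>(\<T> - \<A>))"
      using \<T>(1) by (auto intro!: closed_Inter closed_Union)
    then show "atom \<A> \<in> sets borel"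
      unfolding atom_def by (intro sets.Diff borel_closed)
  qed (use g G in auto)
  show ?thesis
  proof (intro exI conjI subsetI)
    show "finite ((\<lambda>(\<A>, g). abs_l2 (b \<A> g)) ` (?I \<times> G))" using fin G(1) by simp
    fix u :: "'b l2" assume u: "u \<in> L2 \<Omega> \<inter> piecewise \<T> P"
    then have "\<forall>K\<in>\<T>. \<exists>p. p \<in> P \<and> (AE x in lborel. x \<in> K \<longrightarrow> rep_l2 u x = p x)"
      unfolding piecewise_def by blast
    from bchoice[OF this] obtain p where p: "\<And>K. K \<in> \<T> \<Longrightarrow> p K \<in> P"
      "\<And>K. K \<in> \<T> \<Longrightarrow> AE x in lborel. x \<in> K \<longrightarrow> rep_l2 u x = p K x" by blast
    have "\<forall>K\<in>\<T>. \<exists>c. p K = (\<lambda>x. \<Sum>g\<in>G. c g *\<^sub>R g x)" using G(3) p(1) by blast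
    from bchoice[OF this] obtain c
      where c: "\<And>K. K \<in> \<T> \<Longrightarrow> p K = (\<lambda>x. \<Sum>g\<in>G. c K g *\<^sub>R g x)" by blast
    define some_cell where "some_cell \<A> = (SOME K. K \<in> \<A>)" for \<A> :: "space set set"
    have some_cell: "some_cell \<A> \<in> \<A>" if "\<A> \<noteq> {}" for \<A>
      unfolding some_cell_def using that by (simp add: some_in_eq)
    let ?f = "\<lambda>x. \<Sum>\<A>\<in>?I. \<Sum>g\<in>G. c (some_cell \<A>) g *\<^sub>R b \<A> g x"
    have inner: "square_integrable (\<lambda>x. \<Sum>g\<in>G. c (some_cell \<A>) g *\<^sub>R b \<A> g x) \<and>
        abs_l2 (\<lambda>x. \<Sum>g\<in>G. c (some_cell \<A>) g *\<^sub>R b \<A> g x)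
        = (\<Sum>g\<in>G. c (some_cell \<A>) g *\<^sub>R abs_l2 (b \<A> g))" if "\<A> \<in> ?I" for \<A>
      using abs_l2_sum[OF G(1), of "\<lambda>g x. c (some_cell \<A>) g *\<^sub>R b \<A> g x"] sq[OF that]
      by (simp add: square_integrable_scaleR abs_l2_scaleR)
    have outer: "square_integrable ?f \<and>
        abs_l2 ?f = (\<Sum>\<A>\<in>?I. \<Sum>g\<in>G. c (some_cell \<A>) g *\<^sub>R abs_l2 (b \<A> g))"
      using abs_l2_sum[OF fin, of "\<lambda>\<A> x. \<Sum>g\<in>G. c (some_cell \<A>) g *\<^sub>R b \<A> g x"] inner by simp
    have "AE x in lborel. rep_l2 u x = ?f x"
    proof -
      have "AE x in lborel. \<forall>K\<in>\<T>. x \<in> K \<longrightarrow> rep_l2 u x = p K x"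
        using \<T>(1) p(2) by (simp add: AE_finite_allI)
      moreover have "AE x in lborel. x \<notin> \<Omega> \<longrightarrow> rep_l2 u x = 0" using u by (simp add: L2_def)
      ultimately show ?thesis
      proof eventually_elim
        fix x assume on_cells: "\<forall>K\<in>\<T>. x \<in> K \<longrightarrow> rep_l2 u x = p K x"
          and outside: "x \<notin> \<Omega> \<longrightarrow> rep_l2 u x = 0"
        let ?\<A> = "{K \<in> \<T>. x \<in> K}"
        have mem: "x \<in> atom \<A> \<longleftrightarrow> \<A> = ?\<A>" if "\<A> \<in> ?I" for \<A>
          using that by (auto simp: atom_def)
        have "?f x = (\<Sum>\<A>\<in>?I. indicator (atom \<A>) x *\<^sub>R p (some_cell \<A>) x)"
        proof (rule sum.cong[OF refl])
          fix \<A> assume "\<A> \<in> ?I"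
          then have "some_cell \<A> \<in> \<T>" using some_cell by blast
          then show "(\<Sum>g\<in>G. c (some_cell \<A>) g *\<^sub>R b \<A> g x) = indicator (atom \<A>) x *\<^sub>R p (some_cell \<A>) x"
            by (simp add: c b_def scaleR_sum_right mult.commute)
        qed
        also have "\<dots> = (\<Sum>\<A>\<in>?I. if \<A> = ?\<A> then p (some_cell \<A>) x else 0)"
          by (rule sum.cong) (auto simp: mem indicator_def)
        also have "\<dots> = (if ?\<A> \<in> ?I then p (some_cell ?\<A>) x else 0)"
          by (rule sum.delta[OF fin])
        also have "\<dots> = rep_l2 u x"
        proof (cases "?\<A> = {}")
          case True
          then have "x \<notin> \<Omega>" using cover by blast
          with True outside show ?thesis by simp
        next
          case False
          then have "some_cell ?\<A> \<in> ?\<A>" by (rule some_cell)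
          then have "rep_l2 u x = p (some_cell ?\<A>) x" using on_cells by blast
          moreover have "?\<A> \<in> ?I" using False by blast
          ultimately show ?thesis by (simp only: if_True)
        qed
        finally show "rep_l2 u x = ?f x" by simp
      qed
    qed
    then have "u = abs_l2 ?f"
      using abs_l2_eqI[OF square_integrable_rep conjunct1[OF outer], of u] by (simp add: abs_rep_l2)
    also have "\<dots> \<in> span ((\<lambda>(\<A>, g). abs_l2 (b \<A> g)) ` (?I \<times> G))"
      unfolding conjunct2[OF outer] by (intro span_sum span_scale span_base) auto
    finally show "u \<in> span ((\<lambda>(\<A>, g). abs_l2 (b \<A> g)) ` (?I \<times> G))" .
  qed
qed

section \<open>The discrete Hodge Laplacians\<close>

locale discrete_complex = open_domain +
  fixes S :: "real l2 set" and U V :: "(real^3) l2 set" and W :: "real l2 set"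
    and FS :: "real l2 set" and FU FV :: "(real^3) l2 set"
  assumes S: "subspace S" "finite FS" "S \<subseteq> span FS" "S \<subseteq> H1 \<Omega>"
    and U: "subspace U" "finite FU" "U \<subseteq> span FU" "U \<subseteq> Hcurl \<Omega>"
    and V: "subspace V" "finite FV" "V \<subseteq> span FV" "V \<subseteq> Hdiv \<Omega>"
    and exact: "exact_sequence \<Omega> S U V W"
begin

lemma wgrad_linear:
  "\<sigma> \<in> S \<Longrightarrow> \<tau> \<in> S \<Longrightarrow> wgrad \<Omega> (\<sigma> + \<tau>) = wgrad \<Omega> \<sigma> + wgrad \<Omega> \<tau>"
  "\<sigma> \<in> S \<Longrightarrow> wgrad \<Omega> (c *\<^sub>R \<sigma>) = c *\<^sub>R wgrad \<Omega> \<sigma>"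
  using S(4) grad.d_add grad.d_scaleR unfolding domain_eq by blast+

lemma wcurl_linear:
  "u \<in> U \<Longrightarrow> v \<in> U \<Longrightarrow> wcurl \<Omega> (u + v) = wcurl \<Omega> u + wcurl \<Omega> v"
  "u \<in> U \<Longrightarrow> wcurl \<Omega> (c *\<^sub>R u) = c *\<^sub>R wcurl \<Omega> u"
  using U(4) curl.d_add curl.d_scaleR unfolding domain_eq by blast+

lemma wdiv_linear:
  "u \<in> V \<Longrightarrow> v \<in> V \<Longrightarrow> wdiv \<Omega> (u + v) = wdiv \<Omega> u + wdiv \<Omega> v"
  "u \<in> V \<Longrightarrow> wdiv \<Omega> (c *\<^sub>R u) = c *\<^sub>R wdiv \<Omega> u"
  using V(4) div.d_add div.d_scaleR unfolding domain_eq by blast+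

text \<open>
  Exactness yields the definiteness of both Schur complements: a field with vanishing curl is the
  gradient of some \<open>\<tau>\<close>, and testing its discrete weak divergence with \<open>\<tau>\<close> gives its norm. A field with
  vanishing divergence is a curl, and the same argument applies one step further in the sequence.
\<close>

sublocale curl_problem: saddle_problem S U "B_curl \<Omega> S" "transposed U (B_curl \<Omega> S)" "curl_curl \<Omega> U" FS FU
proof
  show "u = 0" if u: "u \<in> U" and K: "curl_curl \<Omega> U u u = 0"
    and D: "\<And>\<tau>. \<tau> \<in> S \<Longrightarrow> B_curl \<Omega> S u \<tau> = 0" for u
  proof -
    have "wcurl \<Omega> u = 0" using K u by (simp add: curl_curl_def)
    with u exact have "u \<in> wgrad \<Omega> ` S" by (auto simp: exact_sequence_def)
    then obtain \<tau> where \<tau>: "\<tau> \<in> S" "u = wgrad \<Omega> \<tau>" by blast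
    then have "u \<bullet> u = 0" using D[OF \<tau>(1)] by (simp add: B_curl_def)
    then show "u = 0" by simp
  qed
qed (use S U in \<open>auto simp: B_curl_def transposed_def curl_curl_def linear_form_on_def
    wgrad_linear wcurl_linear subspace_add subspace_scale inner_add_left inner_add_right inner_commute\<close>)

sublocale div_problem: saddle_problem U V "transposed U (C_div \<Omega> V)" "C_div \<Omega> V" "div_div \<Omega> V" FU FV
proof
  show "u = 0" if u: "u \<in> V" and K: "div_div \<Omega> V u u = 0"
    and D: "\<And>\<tau>. \<tau> \<in> U \<Longrightarrow> transposed U (C_div \<Omega> V) u \<tau> = 0" for u
  proof -
    have "wdiv \<Omega> u = 0" using K u by (simp add: div_div_def)
    with u exact have "u \<in> wcurl \<Omega> ` U" by (auto simp: exact_sequence_def)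
    then obtain \<tau> where \<tau>: "\<tau> \<in> U" "u = wcurl \<Omega> \<tau>" by blast
    then have "u \<bullet> u = 0" using D[OF \<tau>(1)] u by (simp add: C_div_def transposed_def)
    then show "u = 0" by simp
  qed
qed (use U V in \<open>auto simp: C_div_def transposed_def div_div_def linear_form_on_def
    wcurl_linear wdiv_linear subspace_add subspace_scale inner_add_left inner_add_right inner_commute\<close>)

lemma curl_operators:
  "curl_problem.L = L_c \<Omega> S U" "curl_problem.P = P_c \<Omega> S U" "curl_problem.N = norm_c \<Omega> S U"
  by (simp_all add: curl_problem.L_def curl_problem.P_def curl_problem.N_def curl_problem.A_def
      L_c_def P_c_def norm_c_def A_c_def)

lemma div_operators:
  "div_problem.L = L_d \<Omega> U V" "div_problem.P = P_d \<Omega> U V" "div_problem.N = norm_d \<Omega> U V"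
  by (simp_all add: div_problem.L_def div_problem.P_def div_problem.N_def div_problem.A_def
      L_d_def P_d_def norm_d_def A_d_def)

lemmas curl_uniform_preconditioner = curl_problem.uniform_preconditioner[unfolded curl_operators]
lemmas div_uniform_preconditioner = div_problem.uniform_preconditioner[unfolded div_operators]

end

theorem theorem4p5:
  fixes \<Omega> :: "space set" and \<F> :: "space set set set"
    and S :: "space set set \<Rightarrow> real l2 set"
    and U V :: "space set set \<Rightarrow> (real^3) l2 set"
    and W :: "space set set \<Rightarrow> real l2 set"
    and r k l m :: nat and kd kd' :: element_kind
  assumes "convex_polyhedral_domain \<Omega>"
    and "\<forall>\<T>\<in>\<F>. mesh_of \<Omega> \<T>" and "shape_regular \<F>" and "quasi_uniform \<F>"
    and "r \<ge> 1" and "k \<ge> 1" and "l \<ge> 1"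
    and "\<forall>\<T>\<in>\<F>. S \<T> = lagrange_space r \<Omega> \<T>"
    and "\<forall>\<T>\<in>\<F>. U \<T> = edge_space kd k \<Omega> \<T>"
    and "\<forall>\<T>\<in>\<F>. V \<T> = face_space kd' l \<Omega> \<T>"
    and "\<forall>\<T>\<in>\<F>. W \<T> = dg_space m \<Omega> \<T>"
    and "\<forall>\<T>\<in>\<F>. exact_sequence \<Omega> (S \<T>) (U \<T>) (V \<T>) (W \<T>)"
  shows "\<exists>c::real. \<forall>\<T>\<in>\<F>.
    (let PL = P_c \<Omega> (S \<T>) (U \<T>) \<circ> L_c \<Omega> (S \<T>) (U \<T>); X = S \<T> \<times> U \<T>; N = norm_c \<Omega> (S \<T>) (U \<T>) in
       bij_betw PL X X \<and>
       operator_norm X N PL \<le> ennreal c \<and> operator_norm X N (the_inv_into X PL) \<le> ennreal c) \<and>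
    (let PL = P_d \<Omega> (U \<T>) (V \<T>) \<circ> L_d \<Omega> (U \<T>) (V \<T>); X = U \<T> \<times> V \<T>; N = norm_d \<Omega> (U \<T>) (V \<T>) in
       bij_betw PL X X \<and>
       operator_norm X N PL \<le> ennreal c \<and> operator_norm X N (the_inv_into X PL) \<le> ennreal c)"
proof (rule exI[of _ 3], rule ballI)
  fix \<T> assume \<T>: "\<T> \<in> \<F>"
  have \<Omega>: "open_domain \<Omega>"
    using assms(1) by (simp add: open_domain_def convex_polyhedral_domain_def)
  have mesh: "finite \<T>" "\<And>K. K \<in> \<T> \<Longrightarrow> compact K" "\<Omega> \<subseteq> \<Union>\<T>"
    using assms(2) \<T> closure_subset[of \<Omega>]
    by (auto simp: mesh_of_def triangulation_def intro: compact_simplex)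
  have sub: "S \<T> \<subseteq> H1 \<Omega>" "U \<T> \<subseteq> Hcurl \<Omega>" "V \<T> \<subseteq> Hdiv \<Omega>"
    using assms(8-10) \<T>
    by (auto simp: lagrange_space_def edge_space_def face_space_def H1_0_def Hcurl_0_def Hdiv_0_def)
  have subspaces: "subspace (S \<T>)" "subspace (U \<T>)" "subspace (V \<T>)"
    using assms(8-10) \<T>
    by (auto simp: lagrange_space_def edge_space_def face_space_def
        intro!: subspace_inter subspace_piecewise open_domain.subspace_H1_0[OF \<Omega>]
          open_domain.subspace_Hcurl_0[OF \<Omega>] open_domain.subspace_Hdiv_0[OF \<Omega>]
          function_subspace_scalar_poly function_subspace_edge_shapes function_subspace_face_shapes)
  have "S \<T> \<subseteq> L2 \<Omega> \<inter> piecewise \<T> (scalar_poly r)"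
    "U \<T> \<subseteq> L2 \<Omega> \<inter> piecewise \<T> (edge_shapes kd k)"
    "V \<T> \<subseteq> L2 \<Omega> \<inter> piecewise \<T> (face_shapes kd' l)"
    using assms(8-10) \<T> sub
    by (auto simp: lagrange_space_def edge_space_def face_space_def H1_def Hcurl_def Hdiv_def)
  moreover obtain FS FU FV where
    "finite FS" "L2 \<Omega> \<inter> piecewise \<T> (scalar_poly r) \<subseteq> span FS"
    "finite FU" "L2 \<Omega> \<inter> piecewise \<T> (edge_shapes kd k) \<subseteq> span FU"
    "finite FV" "L2 \<Omega> \<inter> piecewise \<T> (face_shapes kd' l) \<subseteq> span FV"
    using finite_dimensional_piecewise[OF mesh finitely_spanned_scalar_poly]
      finite_dimensional_piecewise[OF mesh finitely_spanned_edge_shapes]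
      finite_dimensional_piecewise[OF mesh finitely_spanned_face_shapes] by meson
  ultimately have complex: "discrete_complex \<Omega> (S \<T>) (U \<T>) (V \<T>) (W \<T>) FS FU FV"
    using \<Omega> sub subspaces assms(12) \<T>
    by (auto simp: discrete_complex_def discrete_complex_axioms_def)
  show "(let PL = P_c \<Omega> (S \<T>) (U \<T>) \<circ> L_c \<Omega> (S \<T>) (U \<T>); X = S \<T> \<times> U \<T>; N = norm_c \<Omega> (S \<T>) (U \<T>) in
       bij_betw PL X X \<and>
       operator_norm X N PL \<le> ennreal 3 \<and> operator_norm X N (the_inv_into X PL) \<le> ennreal 3) \<and>
    (let PL = P_d \<Omega> (U \<T>) (V \<T>) \<circ> L_d \<Omega> (U \<T>) (V \<T>); X = U \<T> \<times> V \<T>; N = norm_d \<Omega> (U \<T>) (V \<T>) in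
       bij_betw PL X X \<and>
       operator_norm X N PL \<le> ennreal 3 \<and> operator_norm X N (the_inv_into X PL) \<le> ennreal 3)"
    unfolding Let_def
    using discrete_complex.curl_uniform_preconditioner[OF complex]
      discrete_complex.div_uniform_preconditioner[OF complex] by blast
qed

end
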